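(* Let $\Gamma$ be a distance-regular graph with vertex set $X$ and diameter $d\geqslant 3$ which is $Q$-polynomial with respect to the ordering $\{E_i\}_{i=0}^d$ of its primitive idempotents, and let $Y$ be a nontrivial descendent of $\Gamma$. Suppose the induced subgraph $\Gamma_Y$ is distance-regular. Then a nonempty subset of $Y$ is a descendent of $\Gamma_Y$ (with respect to the induced $Q$-polynomial ordering of $\Gamma_Y$) if and only if it is a descendent of $\Gamma$.
   Context: All graphs are finite, simple and undirected. Let $\Gamma$ be a connected graph with vertex set $X$, path-length distance $\partial$ and diameter $d$; let $A_i\in\mathbb{C}^{X\times X}$ be the adjacency matrix of the distance-$i$ graph ($A_0=I$). $\Gamma$ is distance-regular if there are integers $b_i,c_i$ such that whenever $\partial(x,y)=i$, $y$ has exactly $b_i$ (resp. $c_i$) neighbours at distance $i+1$ (resp. $i-1$) from $x$. Then the Bose--Mesner algebra $\boldsymbol{A}=\langle A_0,\dots,A_d\rangle$ (complex span) is a commutative semisimple algebra with a basis of primitive idempotents $E_0=|X|^{-1}J,E_1,\dots,E_d$. $\Gamma$ is $Q$-polynomial with respect to the ordering $\{E_i\}_{i=0}^d$ if there are scalars $a_i^*,b_i^*,c_i^*$ with $b_d^*=c_0^*=0$, $b_{i-1}^*c_i^*\neq 0$ $(1\leqslant i\leqslant d)$ and $E_1\circ E_i=|X|^{-1}(b_{i-1}^*E_{i-1}+a_i^*E_i+c_{i+1}^*E_{i+1})$ $(0\leqslant i\leqslant d)$, where $\circ$ is the entrywise product, $E_{-1}=E_{d+1}=0$, $b_{-1}^*=c_{d+1}^*=0$.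 For a nonempty $Y\subseteq X$ with characteristic vector $\hat Y$, the width is $w=\max\{i:\hat Y^{\mathsf T}A_i\hat Y\neq 0\}$ and the dual width is $w^*=\max\{i:\hat Y^{\mathsf T}E_i\hat Y\neq 0\}$. One always has $w+w^*\geqslant d$; $Y$ is a descendent of $\Gamma$ if $w+w^*=d$, trivial if moreover $w=0$ or $w=d$, nontrivial otherwise. $\Gamma_Y$ is the induced subgraph on $Y$. For a descendent $Y$ the relations $\{(x,y)\in Y\times Y:\partial(x,y)=i\}$ $(0\leqslant i\leqslant w)$ form an association scheme with $w$ classes on $Y$, whose primitive idempotents have a $Q$-polynomial ordering $E_0',\dots,E_w'$ determined by $\langle E_0',\dots,E_i'\rangle=\langle\breve E_0,\dots,\breve E_i\rangle$ $(0\leqslant i\leqslant w)$, where $\breve B$ is the principal submatrix of $B$ on $Y$. If $\Gamma_Y$ is connected (equivalently, distance-regular) it has diameter $w$ and is regarded as $Q$-polynomial with respect to this induced ordering; width, dual width and descendents of $\Gamma_Y$ are defined as for $\Gamma$ using this ordering. *)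

theory Defs
  imports "HOL-Analysis.Analysis"
begin

text \<open>
  A finite simple graph is a pair of a vertex set \<open>X\<close> and a symmetric irreflexive relation \<open>R\<close>
  on \<open>X\<close> (each edge occurs in both orientations).
\<close>

definition simple_graph :: "'v set \<Rightarrow> ('v \<times> 'v) set \<Rightarrow> bool" where
  "simple_graph X R \<longleftrightarrow> finite X \<and> R \<subseteq> X \<times> X \<and> sym R \<and> irrefl R"

definition connected_graph :: "'v set \<Rightarrow> ('v \<times> 'v) set \<Rightarrow> bool" where
  "connected_graph X R \<longleftrightarrow> X \<noteq> {} \<and> (\<forall>x\<in>X. \<forall>y\<in>X. (x, y) \<in> R\<^sup>*)"

definition induced_edges :: "('v \<times> 'v) set \<Rightarrow> 'v set \<Rightarrow> ('v \<times> 'v) set" where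
  "induced_edges R Y = R \<inter> (Y \<times> Y)"

text \<open>
  \<open>(x, y) \<in> R ^^ n\<close> says that there is a walk of length \<open>n\<close> from \<open>x\<close> to \<open>y\<close>. The distance and
  the diameter are only meaningful for connected graphs.
\<close>

definition graph_dist :: "('v \<times> 'v) set \<Rightarrow> 'v \<Rightarrow> 'v \<Rightarrow> nat" where
  "graph_dist R x y = (LEAST n. (x, y) \<in> R ^^ n)"

definition graph_diam :: "'v set \<Rightarrow> ('v \<times> 'v) set \<Rightarrow> nat" where
  "graph_diam X R = Max {graph_dist R x y | x y. x \<in> X \<and> y \<in> X}"

definition distance_regular :: "'v set \<Rightarrow> ('v \<times> 'v) set \<Rightarrow> bool" where
  "distance_regular X R \<longleftrightarrow> simple_graph X R \<and> connected_graph X R \<and>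
     (\<exists>b c :: nat \<Rightarrow> nat. \<forall>x\<in>X. \<forall>y\<in>X.
        card {z. (y, z) \<in> R \<and> graph_dist R x z = graph_dist R x y + 1} = b (graph_dist R x y) \<and>
        card {z. (y, z) \<in> R \<and> graph_dist R x z + 1 = graph_dist R x y} = c (graph_dist R x y))"

text \<open>
  Matrices in \<open>\<complex>\<^sup>X\<^sup>\<times>\<^sup>X\<close> are represented by matrices over the whole (finite) ambient vertex type
  that vanish outside \<open>X \<times> X\<close>. This way the graph and its induced subgraphs share one matrix type;
  \<open>**\<close> restricts to the usual product in \<open>\<complex>\<^sup>X\<^sup>\<times>\<^sup>X\<close>, whose identity is \<open>dist_matrix X R 0\<close>.
\<close>

definition cmat_scale :: "complex \<Rightarrow> complex^'n^'m \<Rightarrow> complex^'n^'m" where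
  "cmat_scale a M = (\<chi> x y. a * M $ x $ y)"

interpretation cmat: vector_space cmat_scale
  by unfold_locales (simp_all add: cmat_scale_def vec_eq_iff algebra_simps)

definition hadamard :: "complex^'n^'m \<Rightarrow> complex^'n^'m \<Rightarrow> complex^'n^'m" where
  "hadamard M N = (\<chi> x y. M $ x $ y * N $ x $ y)"

definition all_ones :: "'v set \<Rightarrow> complex^'v^'v" where
  "all_ones X = (\<chi> x y. if x \<in> X \<and> y \<in> X then 1 else 0)"

definition principal_submatrix :: "'v set \<Rightarrow> complex^'v^'v \<Rightarrow> complex^'v^'v" where
  "principal_submatrix Y M = (\<chi> x y. if x \<in> Y \<and> y \<in> Y then M $ x $ y else 0)"

definition dist_matrix :: "'v set \<Rightarrow> ('v \<times> 'v) set \<Rightarrow> nat \<Rightarrow> complex^'v^'v" where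
  "dist_matrix X R i =
     (\<chi> x y. if x \<in> X \<and> y \<in> X \<and> graph_dist R x y = i then 1 else 0)"

definition bose_mesner :: "'v::finite set \<Rightarrow> ('v \<times> 'v) set \<Rightarrow> (complex^'v^'v) set" where
  "bose_mesner X R = cmat.span (dist_matrix X R ` {..graph_diam X R})"

definition primitive_idempotent :: "(complex^'v^'v) set \<Rightarrow> complex^'v^'v \<Rightarrow> bool" where
  "primitive_idempotent \<A> P \<longleftrightarrow> P \<in> \<A> \<and> P \<noteq> 0 \<and> P ** P = P \<and>
     \<not> (\<exists>F\<in>\<A>. \<exists>G\<in>\<A>. F \<noteq> 0 \<and> G \<noteq> 0 \<and> F ** F = F \<and> G ** G = G \<and>
            F ** G = 0 \<and> G ** F = 0 \<and> P = F + G)"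

text \<open>
  Only the values \<open>E 0, \<dots>, E d\<close> matter. The terms with index \<open>-1\<close> and \<open>d + 1\<close> in the recurrence
  are zero by convention and are dropped by the case distinctions.
\<close>

definition q_polynomial ::
    "'v::finite set \<Rightarrow> ('v \<times> 'v) set \<Rightarrow> (nat \<Rightarrow> complex^'v^'v) \<Rightarrow> bool" where
  "q_polynomial X R E \<longleftrightarrow>
     (let d = graph_diam X R; n = of_nat (card X) in
        bij_betw E {..d} {P. primitive_idempotent (bose_mesner X R) P} \<and>
        E 0 = cmat_scale (1 / n) (all_ones X) \<and>
        (\<exists>a b c :: nat \<Rightarrow> complex.
           b d = 0 \<and> c 0 = 0 \<and> (\<forall>i\<in>{1..d}. b (i - 1) * c i \<noteq> 0) \<and>
           (\<forall>i\<le>d. hadamard (E 1) (E i) =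
              cmat_scale (1 / n)
                ((if i = 0 then 0 else cmat_scale (b (i - 1)) (E (i - 1)))
                 + cmat_scale (a i) (E i)
                 + (if i = d then 0 else cmat_scale (c (i + 1)) (E (i + 1)))))))"

definition char_vec :: "'v set \<Rightarrow> complex^'v" where
  "char_vec Y = (\<chi> x. if x \<in> Y then 1 else 0)"

definition char_form :: "'v::finite set \<Rightarrow> complex^'v^'v \<Rightarrow> complex" where
  "char_form Y M = (\<Sum>x\<in>UNIV. char_vec Y $ x * (M *v char_vec Y) $ x)"

definition width :: "'v::finite set \<Rightarrow> ('v \<times> 'v) set \<Rightarrow> 'v set \<Rightarrow> nat" where
  "width X R Y = Max {i. i \<le> graph_diam X R \<and> char_form Y (dist_matrix X R i) \<noteq> 0}"

definition dual_width ::
    "'v::finite set \<Rightarrow> ('v \<times> 'v) set \<Rightarrow> (nat \<Rightarrow> complex^'v^'v) \<Rightarrow> 'v set \<Rightarrow> nat" where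
  "dual_width X R E Y = Max {i. i \<le> graph_diam X R \<and> char_form Y (E i) \<noteq> 0}"

definition descendent ::
    "'v::finite set \<Rightarrow> ('v \<times> 'v) set \<Rightarrow> (nat \<Rightarrow> complex^'v^'v) \<Rightarrow> 'v set \<Rightarrow> bool" where
  "descendent X R E Y \<longleftrightarrow>
     Y \<noteq> {} \<and> Y \<subseteq> X \<and> width X R Y + dual_width X R E Y = graph_diam X R"

definition nontrivial_descendent ::
    "'v::finite set \<Rightarrow> ('v \<times> 'v) set \<Rightarrow> (nat \<Rightarrow> complex^'v^'v) \<Rightarrow> 'v set \<Rightarrow> bool" where
  "nontrivial_descendent X R E Y \<longleftrightarrow>
     descendent X R E Y \<and> width X R Y \<noteq> 0 \<and> width X R Y \<noteq> graph_diam X R"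

text \<open>
  \<open>E'\<close> lists the primitive idempotents of the association scheme induced on \<open>Y\<close>, whose relations
  are given by the distance in the \<^emph>\<open>ambient\<close> graph, in the induced ordering. The equalities of the
  spans determine \<open>E' 0, \<dots>, E' w\<close> uniquely.
\<close>

definition induced_ordering ::
    "'v::finite set \<Rightarrow> ('v \<times> 'v) set \<Rightarrow> (nat \<Rightarrow> complex^'v^'v) \<Rightarrow> 'v set
      \<Rightarrow> (nat \<Rightarrow> complex^'v^'v) \<Rightarrow> bool" where
  "induced_ordering X R E Y E' \<longleftrightarrow>
     (let w = width X R Y;
          \<A> = cmat.span ((\<lambda>i. principal_submatrix Y (dist_matrix X R i)) ` {..w})
      in bij_betw E' {..w} {P. primitive_idempotent \<A> P} \<and>
         (\<forall>i\<le>w. cmat.span (E' ` {..i}) =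
                 cmat.span ((\<lambda>j. principal_submatrix Y (E j)) ` {..i})))"

end

(*
  Write e_j for the principal submatrix of E_j on Y, s for the dual width of Y and w = d - s for its
  width, and let T_k be the span of e_{s+k}, ..., e_d. The Q-polynomial property makes e_i e_j vanish
  for j - i > s, while the trace of e_i e_{i+s} is nonzero. Hence both e_0, ..., e_w and
  e_s, ..., e_d are bases of the span B of the restricted distance matrices, and B is the direct sum
  of <e_0, ..., e_{k-1}> and T_k, whose product is zero. Induction on k then shows that B is closed
  under multiplication; connectedness of the induced subgraph makes its distance agree with the
  ambient one, so that widths agree. Since the induced idempotents E'_0, ..., E'_{k-1} span
  <e_0, ..., e_{k-1}>, the remaining ones span T_k, and so the dual width of a subset of Y drops by
  exactly s when passing from the ambient graph to the induced subgraph.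
*)

theory Submission
  imports Defs
begin

section \<open>Matrices\<close>

text \<open>Restriction to a principal submatrix is not multiplicative, so closure of the restricted
  span under products cannot be inherited from the ambient algebra; it has to come from
  orthogonality relations among the \<open>e j\<close>. These rest on one scalar, the sum of the
  entries of \<open>hadamard (E i) (E j)\<close> over \<open>Y\<close>. For real symmetric
  idempotents it is a squared norm, so its vanishing forces \<open>e i ** e j = 0\<close>. The
  recurrence for \<open>E 1\<close> expands the Hadamard product into a nonzero multiple of
  \<open>E (j - i)\<close> plus idempotents of larger index, and the forms of these on
  \<open>Y\<close> vanish beyond index \<open>s\<close>. At \<open>j - i = s\<close> the scalar is
  nonzero, which makes it a triangular pairing for linear independence. Minimality
  \<open>w + s = d\<close> enters as a count: \<open>{..w}\<close> and \<open>{s..d}\<close> both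
  have \<open>w + 1\<close> members, as many as the restricted distance matrices.\<close>

lemma cmat_scale_nth [simp]: "cmat_scale a M $ x $ y = a * M $ x $ y"
  by (simp add: cmat_scale_def)

lemma hadamard_nth [simp]: "hadamard M N $ x $ y = M $ x $ y * N $ x $ y"
  by (simp add: hadamard_def)

lemma principal_submatrix_nth [simp]:
  "principal_submatrix Y M $ x $ y = (if x \<in> Y \<and> y \<in> Y then M $ x $ y else 0)"
  by (simp add: principal_submatrix_def)

lemma dist_matrix_nth [simp]:
  "dist_matrix X R i $ x $ y = (if x \<in> X \<and> y \<in> X \<and> graph_dist R x y = i then 1 else 0)"
  by (simp add: dist_matrix_def)

lemma principal_submatrix_dist_matrix:
  "Y \<subseteq> X \<Longrightarrow> principal_submatrix Y (dist_matrix X R i) = dist_matrix Y R i"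
  by (auto simp: vec_eq_iff)

lemma matrix_mult_nth: "(M ** N) $ x $ y = (\<Sum>z\<in>UNIV. M $ x $ z * N $ z $ y)"
  by (simp add: matrix_matrix_mult_def)

lemma scale_matrix_mult: "cmat_scale a M ** N = cmat_scale a (M ** N)"
  by (simp add: vec_eq_iff matrix_mult_nth sum_distrib_left mult.assoc)

lemma matrix_mult_scale: "M ** cmat_scale a N = cmat_scale a (M ** N)"
  by (simp add: vec_eq_iff matrix_mult_nth sum_distrib_left mult_ac)

lemma matrix_add_rdistrib: "(A + B) ** C = A ** C + B ** (C :: complex^'n^'m)"
  by (simp add: vec_eq_iff matrix_mult_nth distrib_right sum.distrib)

lemma matrix_diff_ldistrib: "A ** (B - C) = A ** B - A ** (C :: complex^'n^'m)"
  by (simp add: vec_eq_iff matrix_mult_nth right_diff_distrib sum_subtractf)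

lemma matrix_diff_rdistrib: "(A - B) ** C = A ** C - B ** (C :: complex^'n^'m)"
  by (simp add: vec_eq_iff matrix_mult_nth left_diff_distrib sum_subtractf)

lemma sum_nth2: "(\<Sum>i\<in>I. f i) $ x $ y = (\<Sum>i\<in>I. f i $ x $ y)"
  by (induction I rule: infinite_finite_induct) auto

lemma sum_matrix_mult:
  fixes f :: "'i \<Rightarrow> complex^'n^'m"
  shows "(\<Sum>i\<in>I. f i) ** N = (\<Sum>i\<in>I. f i ** N)"
  by (induction I rule: infinite_finite_induct) (auto simp: matrix_add_rdistrib)

lemma matrix_mult_sum:
  fixes f :: "'i \<Rightarrow> complex^'n^'m"
  shows "M ** (\<Sum>i\<in>I. f i) = (\<Sum>i\<in>I. M ** f i)"
  by (induction I rule: infinite_finite_induct) (auto simp: matrix_add_ldistrib)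

lemma symmetric_nth:
  assumes "transpose M = M"
  shows "M $ a $ b = M $ b $ a"
  by (subst assms[symmetric]) (simp add: transpose_def)

lemma transpose_mult_symmetric:
  fixes M N :: "complex^'n^'n"
  assumes "transpose M = M" "transpose N = N"
  shows "transpose (M ** N) = N ** M"
  by (simp add: matrix_transpose_mul assms)

section \<open>Entrywise conjugation and symmetric matrices\<close>

definition cnj_mat :: "complex^'n^'m \<Rightarrow> complex^'n^'m" where
  "cnj_mat M = (\<chi> x y. cnj (M $ x $ y))"

lemma cnj_mat_nth [simp]: "cnj_mat M $ x $ y = cnj (M $ x $ y)"
  by (simp add: cnj_mat_def)

lemma cnj_mat_mult: "cnj_mat (M ** N) = cnj_mat M ** cnj_mat N"
  by (simp add: vec_eq_iff matrix_mult_nth)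

lemma cnj_mat_cnj_mat [simp]: "cnj_mat (cnj_mat M) = M"
  by (simp add: vec_eq_iff)

lemma cnj_mat_add: "cnj_mat (M + N) = cnj_mat M + cnj_mat N"
  by (simp add: vec_eq_iff)

lemma cnj_mat_0 [simp]: "cnj_mat 0 = 0"
  by (simp add: vec_eq_iff)

lemma cnj_mat_eq_0_iff [simp]: "cnj_mat M = 0 \<longleftrightarrow> M = 0"
  by (simp add: vec_eq_iff)

text \<open>By symmetry, the diagonal entries of \<open>cnj_mat M ** M\<close> are the sums of
  squared moduli along the columns of \<open>M\<close>. The conjugate is essential: a nonzero
  complex symmetric matrix can have square zero.\<close>

lemma cnj_mult_symmetric_eq_0:
  fixes M :: "complex^'n^'n"
  assumes sym: "transpose M = M" and zero: "cnj_mat M ** M = 0"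
  shows "M = 0"
proof -
  have "M $ y $ x = 0" for x y
  proof -
    have tr: "M $ a $ b = M $ b $ a" for a b
      using sym by (rule symmetric_nth)
    have "0 = (cnj_mat M ** M) $ x $ x"
      using zero by simp
    also have "\<dots> = (\<Sum>z\<in>UNIV. complex_of_real ((cmod (M $ z $ x))\<^sup>2))"
      unfolding matrix_mult_nth cnj_mat_nth complex_norm_square
      by (subst tr[of x]) (simp only: mult.commute)
    also have "\<dots> = complex_of_real (\<Sum>z\<in>UNIV. (cmod (M $ z $ x))\<^sup>2)"
      by simp
    finally have "(\<Sum>z\<in>UNIV. (cmod (M $ z $ x))\<^sup>2) = 0"
      by (metis of_real_eq_0_iff)
    then show ?thesis
      by (simp add: sum_nonneg_eq_0_iff)
  qed
  then show ?thesis
    by (simp add: vec_eq_iff)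
qed

lemma cnj_mat_span:
  assumes "\<And>B. B \<in> S \<Longrightarrow> cnj_mat B = B" and "M \<in> cmat.span S"
  shows "cnj_mat M \<in> cmat.span S"
  using assms(2)
proof (induction rule: cmat.span_induct_alt)
  case base
  show ?case by (simp add: cmat.span_zero)
next
  case (step c x y)
  have "cnj_mat (cmat_scale c x + y) = cmat_scale (cnj c) x + cnj_mat y"
    using assms(1)[OF step(1)] by (simp add: vec_eq_iff)
  then show ?case
    using step by (simp add: cmat.span_add cmat.span_base cmat.span_scale)
qed

lemma symmetric_span:
  fixes M :: "complex^'n^'n"
  assumes "\<And>B. B \<in> S \<Longrightarrow> transpose B = B" and "M \<in> cmat.span S"
  shows "transpose M = M"
  using assms(2)
proof (induction rule: cmat.span_induct_alt)
  case base
  show ?case by (simp add: vec_eq_iff transpose_def)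
next
  case (step c x y)
  then show ?case
    using assms(1)[OF step(1)] by (simp add: vec_eq_iff transpose_def)
qed

lemma matrix_mult_span_right:
  assumes "\<And>N. N \<in> S \<Longrightarrow> M ** N \<in> cmat.span T" and "N \<in> cmat.span S"
  shows "M ** N \<in> cmat.span T"
  using assms(2)
  by (induction rule: cmat.span_induct_alt)
     (auto simp: matrix_add_ldistrib matrix_mult_scale assms(1)
       cmat.span_zero cmat.span_add cmat.span_scale)

lemma matrix_mult_span_left:
  assumes "\<And>M. M \<in> S \<Longrightarrow> M ** N \<in> cmat.span T" and "M \<in> cmat.span S"
  shows "M ** N \<in> cmat.span T"
  using assms(2)
  by (induction rule: cmat.span_induct_alt)
     (auto simp: matrix_add_rdistrib scale_matrix_mult assms(1)
       cmat.span_zero cmat.span_add cmat.span_scale)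

lemma matrix_mult_span_eq_0:
  assumes "\<And>M N. M \<in> S \<Longrightarrow> N \<in> T \<Longrightarrow> M ** N = 0" "M \<in> cmat.span S" "N \<in> cmat.span T"
  shows "M ** N = 0"
proof -
  have "M ** N \<in> cmat.span {}"
    by (rule matrix_mult_span_left[OF matrix_mult_span_right])
       (use assms in auto)
  then show ?thesis by simp
qed

section \<open>Independent families\<close>

lemma span_image_eq_sum:
  assumes "finite I" "M \<in> cmat.span (f ` I)"
  obtains c where "M = (\<Sum>i\<in>I. cmat_scale (c i) (f i))"
proof -
  have "\<exists>c. M = (\<Sum>i\<in>I. cmat_scale (c i) (f i))"
    using assms(2)
  proof (induction rule: cmat.span_induct_alt)
    case base
    have "0 = (\<Sum>i\<in>I. cmat_scale 0 (f i))" by simp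
    then show ?case by (rule exI[where x = "\<lambda>_. 0"])
  next
    case (step a x y)
    then obtain c j where c: "y = (\<Sum>i\<in>I. cmat_scale (c i) (f i))" and j: "j \<in> I" "x = f j"
      by auto
    have "cmat_scale a x + y = (\<Sum>i\<in>I. cmat_scale ((if i = j then a else 0) + c i) (f i))"
      using j assms(1)
      by (simp add: c cmat.scale_left_distrib sum.distrib if_distrib[of "\<lambda>t. cmat_scale t _"]
          sum.delta cong: if_cong)
    then show ?case by (rule exI[where x = "\<lambda>i. (if i = j then a else 0) + c i"])
  qed
  then show ?thesis using that by blast
qed

text \<open>Independence is stated for the indexed family, so that sums can be taken over indices;
  injectivity of \<open>f\<close> on \<open>I\<close> is then a consequence, which gives access to
  the set-based independence of the library.\<close>

definition indep_family :: "('i \<Rightarrow> complex^'n^'m) \<Rightarrow> 'i set \<Rightarrow> bool" where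
  "indep_family f I \<longleftrightarrow>
     (\<forall>c. (\<Sum>i\<in>I. cmat_scale (c i) (f i)) = 0 \<longrightarrow> (\<forall>i\<in>I. c i = 0))"

lemma indep_familyD:
  "indep_family f I \<Longrightarrow> (\<Sum>i\<in>I. cmat_scale (c i) (f i)) = 0 \<Longrightarrow> i \<in> I \<Longrightarrow> c i = 0"
  by (auto simp: indep_family_def)

lemma indep_family_subset:
  assumes "indep_family f I" "J \<subseteq> I" "finite I"
  shows "indep_family f J"
  unfolding indep_family_def
proof (intro allI impI ballI)
  fix c j assume z: "(\<Sum>i\<in>J. cmat_scale (c i) (f i)) = 0" and j: "j \<in> J"
  have "(\<Sum>i\<in>I. cmat_scale (if i \<in> J then c i else 0) (f i)) = (\<Sum>i\<in>J. cmat_scale (c i) (f i))"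
    by (rule sum.mono_neutral_cong_right) (use assms in auto)
  then show "c j = 0"
    using indep_familyD[OF assms(1), of "\<lambda>i. if i \<in> J then c i else 0" j] z j assms(2) by auto
qed

lemma indep_family_inj_on:
  assumes "indep_family f I" "finite I"
  shows "inj_on f I"
proof (rule inj_onI, rule ccontr)
  fix i j assume ij: "i \<in> I" "j \<in> I" "f i = f j" "i \<noteq> j"
  let ?c = "\<lambda>l. if l = i then 1 else if l = j then - 1 else 0 :: complex"
  have "(\<Sum>l\<in>I. cmat_scale (?c l) (f l)) = (\<Sum>l\<in>{i, j}. cmat_scale (?c l) (f l))"
    by (rule sum.mono_neutral_right) (use assms ij in auto)
  also have "\<dots> = 0"
    using ij by simp
  finally show False
    using indep_familyD[OF assms(1), of ?c i] ij by auto
qed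

lemma indep_family_independent:
  assumes "indep_family f I" "finite I"
  shows "cmat.independent (f ` I)"
proof -
  have inj: "inj_on f I" using indep_family_inj_on[OF assms] .
  show ?thesis
  proof (rule cmat.independent_if_scalars_zero)
    show "finite (f ` I)" using assms by simp
    fix u x assume z: "(\<Sum>x\<in>f ` I. cmat_scale (u x) x) = 0" and x: "x \<in> f ` I"
    have "(\<Sum>i\<in>I. cmat_scale (u (f i)) (f i)) = 0"
      using z by (simp add: sum.reindex[OF inj])
    then show "u x = 0"
      using indep_familyD[OF assms(1), of "\<lambda>i. u (f i)"] x by auto
  qed
qed

lemma indep_family_not_in_span:
  assumes "indep_family f I" "finite I" "j \<in> I" "J \<subseteq> I - {j}"
  shows "f j \<notin> cmat.span (f ` J)"
proof
  assume "f j \<in> cmat.span (f ` J)"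
  moreover have "f ` J \<subseteq> f ` I - {f j}"
    using indep_family_inj_on[OF assms(1,2)] assms(3,4) by (auto simp: inj_on_def)
  ultimately have "f j \<in> cmat.span (f ` I - {f j})"
    using cmat.span_mono by blast
  then show False
    using indep_family_independent[OF assms(1,2)] assms(3) cmat.dependent_def by blast
qed

lemma span_subset_indep_family:
  assumes "indep_family f I" "finite I" "finite J" "card J \<le> card I"
    and sub: "f ` I \<subseteq> cmat.span (g ` J)"
  shows "cmat.span (g ` J) \<subseteq> cmat.span (f ` I)"
proof
  fix M assume M: "M \<in> cmat.span (g ` J)"
  have ind: "cmat.independent (f ` I)" by (rule indep_family_independent[OF assms(1,2)])
  have cI: "card (f ` I) = card I"
    by (rule card_image[OF indep_family_inj_on[OF assms(1,2)]])
  show "M \<in> cmat.span (f ` I)"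
  proof (rule ccontr)
    assume n: "M \<notin> cmat.span (f ` I)"
    then have "cmat.independent (insert M (f ` I))"
      using ind by (simp add: cmat.independent_insert)
    then have "card (insert M (f ` I)) \<le> card (g ` J)"
      using cmat.independent_span_bound[of "g ` J" "insert M (f ` I)"] M sub assms(3) by auto
    moreover have "M \<notin> f ` I" using n cmat.span_base by blast
    moreover have "card (g ` J) \<le> card J" by (rule card_image_le[OF assms(3)])
    ultimately show False using cI assms(2,4) by simp
  qed
qed

section \<open>Primitive idempotents\<close>

text \<open>If \<open>P ** Q\<close> is neither \<open>0\<close> nor \<open>P\<close>, then
  \<open>P = P ** Q + (P - P ** Q)\<close> is a forbidden splitting of \<open>P\<close>. So a
  nonzero product equals \<open>P\<close>, and by symmetry of the argument also
  \<open>Q\<close>.\<close>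

lemma primitive_idempotents_orthogonal:
  assumes sub: "cmat.subspace \<A>"
    and closed: "\<And>M N. M \<in> \<A> \<Longrightarrow> N \<in> \<A> \<Longrightarrow> M ** N \<in> \<A>"
    and comm: "\<And>M N. M \<in> \<A> \<Longrightarrow> N \<in> \<A> \<Longrightarrow> M ** N = N ** M"
    and P: "primitive_idempotent \<A> P" and Q: "primitive_idempotent \<A> Q" and ne: "P \<noteq> Q"
  shows "P ** Q = 0"
proof (rule ccontr)
  assume nz: "P ** Q \<noteq> 0"
  have absorb: "P ** Q = P"
    if P: "primitive_idempotent \<A> P" and Q: "primitive_idempotent \<A> Q" and nz: "P ** Q \<noteq> 0"
    for P Q
  proof (rule ccontr)
    assume "P ** Q \<noteq> P"
    have in_A: "P \<in> \<A>" "Q \<in> \<A>" and idem: "P ** P = P" "Q ** Q = Q"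
      using P Q by (auto simp: primitive_idempotent_def)
    let ?F = "P ** Q" and ?G = "P - P ** Q"
    have comm': "Q ** P = P ** Q" using comm in_A by simp
    have FP: "?F ** P = ?F" "P ** ?F = ?F" "?F ** ?F = ?F"
      by (metis comm' idem matrix_mul_assoc)+
    have "?F \<in> \<A>" "?G \<in> \<A>"
      using closed in_A cmat.subspace_diff[OF sub] by auto
    moreover have "?F ** ?G = 0" "?G ** ?F = 0" "?G ** ?G = ?G"
      using FP idem by (simp_all add: matrix_diff_ldistrib matrix_diff_rdistrib)
    moreover have "P = ?F + ?G" "?G \<noteq> 0"
      using \<open>P ** Q \<noteq> P\<close> by auto
    ultimately show False
      using P nz FP(3) unfolding primitive_idempotent_def by blast
  qed
  have "P ** Q = Q ** P"
    using comm P Q by (auto simp: primitive_idempotent_def)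
  then show False
    using absorb[OF P Q nz] absorb[OF Q P] nz ne by simp
qed

text \<open>Conjugation carries splittings to splittings, so \<open>cnj_mat P\<close> is again
  primitive. If it differed from \<open>P\<close>, orthogonality would give
  \<open>cnj_mat P ** P = 0\<close>, hence \<open>P = 0\<close> by symmetry.\<close>

lemma primitive_idempotent_real:
  assumes sub: "cmat.subspace \<A>"
    and closed: "\<And>M N. M \<in> \<A> \<Longrightarrow> N \<in> \<A> \<Longrightarrow> M ** N \<in> \<A>"
    and sym: "\<And>M. M \<in> \<A> \<Longrightarrow> transpose M = M"
    and cnj: "\<And>M. M \<in> \<A> \<Longrightarrow> cnj_mat M \<in> \<A>"
    and P: "primitive_idempotent \<A> P"
  shows "cnj_mat P = P"
proof (rule ccontr)
  assume ne: "cnj_mat P \<noteq> P"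
  have comm: "M ** N = N ** M" if "M \<in> \<A>" "N \<in> \<A>" for M N
    using transpose_mult_symmetric[of M N] sym closed that by simp
  have "primitive_idempotent \<A> (cnj_mat P)"
    unfolding primitive_idempotent_def
  proof (intro conjI notI)
    show "cnj_mat P \<in> \<A>" "cnj_mat P = 0 \<Longrightarrow> False" "cnj_mat P ** cnj_mat P = cnj_mat P"
      using P cnj by (auto simp: primitive_idempotent_def simp flip: cnj_mat_mult)
    assume "\<exists>F\<in>\<A>. \<exists>G\<in>\<A>. F \<noteq> 0 \<and> G \<noteq> 0 \<and> F ** F = F \<and> G ** G = G \<and> F ** G = 0 \<and> G ** F = 0 \<and>
      cnj_mat P = F + G"
    then obtain F G where "F \<in> \<A>" "G \<in> \<A>" "F \<noteq> 0" "G \<noteq> 0" "F ** F = F" "G ** G = G"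
      "F ** G = 0" "G ** F = 0" and PFG: "cnj_mat P = F + G"
      by blast
    then have "cnj_mat F \<in> \<A>" "cnj_mat G \<in> \<A>" "cnj_mat F \<noteq> 0" "cnj_mat G \<noteq> 0"
      "cnj_mat F ** cnj_mat F = cnj_mat F" "cnj_mat G ** cnj_mat G = cnj_mat G"
      "cnj_mat F ** cnj_mat G = 0" "cnj_mat G ** cnj_mat F = 0"
      using cnj by (simp_all flip: cnj_mat_mult)
    moreover have "P = cnj_mat F + cnj_mat G"
      using PFG by (metis cnj_mat_add cnj_mat_cnj_mat)
    ultimately show False
      using P unfolding primitive_idempotent_def by blast
  qed
  then have "cnj_mat P ** P = 0"
    using primitive_idempotents_orthogonal[OF sub closed comm _ P ne] by blast
  then have "P = 0"
    using cnj_mult_symmetric_eq_0 sym P by (auto simp: primitive_idempotent_def)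
  then show False
    using P by (simp add: primitive_idempotent_def)
qed

section \<open>Quadratic forms of characteristic vectors\<close>

lemma char_form_eq: "char_form Y M = (\<Sum>x\<in>Y. \<Sum>y\<in>Y. M $ x $ y)"
proof -
  have "char_form Y M = (\<Sum>x\<in>UNIV. if x \<in> Y then (\<Sum>y\<in>UNIV. if y \<in> Y then M $ x $ y else 0) else 0)"
    unfolding char_form_def char_vec_def matrix_vector_mult_def
    by (intro sum.cong refl) (auto intro!: sum.cong)
  then show ?thesis
    by (simp flip: sum.inter_filter)
qed

lemma char_form_add: "char_form Y (M + N) = char_form Y M + char_form Y N"
  by (simp add: char_form_eq sum.distrib)

lemma char_form_scale: "char_form Y (cmat_scale a M) = a * char_form Y M"
  by (simp add: char_form_eq sum_distrib_left)

lemma char_form_0 [simp]: "char_form Y 0 = 0"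
  by (simp add: char_form_eq)

lemma char_form_span_eq_0:
  assumes "\<And>B. B \<in> S \<Longrightarrow> char_form Y B = 0" and "M \<in> cmat.span S"
  shows "char_form Y M = 0"
  using assms(2)
  by (induction rule: cmat.span_induct_alt) (auto simp: assms(1) char_form_add char_form_scale)

lemma char_form_principal_submatrix:
  "Z \<subseteq> Y \<Longrightarrow> char_form Z (principal_submatrix Y M) = char_form Z M"
  unfolding char_form_eq by (intro sum.cong refl) auto

text \<open>The form counts ordered pairs at distance \<open>i\<close>, so nothing can
  cancel.\<close>

lemma char_form_dist_matrix_eq_0_iff:
  assumes "Y \<subseteq> X"
  shows "char_form Y (dist_matrix X R i) = 0 \<longleftrightarrow> (\<forall>x\<in>Y. \<forall>y\<in>Y. graph_dist R x y \<noteq> i)"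
proof -
  have "char_form Y (dist_matrix X R i) = of_nat (\<Sum>x\<in>Y. \<Sum>y\<in>Y. if graph_dist R x y = i then 1 else 0)"
    using assms unfolding char_form_eq of_nat_sum by (intro sum.cong refl) (auto simp: subset_iff)
  then show ?thesis by (simp only: of_nat_eq_0_iff) auto
qed

lemma principal_submatrix_mult_nth:
  fixes P Q :: "complex^'v::finite^'v"
  shows "(principal_submatrix Y P ** principal_submatrix Y Q) $ x $ y =
    (if x \<in> Y \<and> y \<in> Y then \<Sum>z\<in>Y. P $ x $ z * Q $ z $ y else 0)"
proof -
  have "(\<Sum>z\<in>UNIV. principal_submatrix Y P $ x $ z * principal_submatrix Y Q $ z $ y) =
    (\<Sum>z\<in>Y. principal_submatrix Y P $ x $ z * principal_submatrix Y Q $ z $ y)"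
    by (rule sum.mono_neutral_right) auto
  then show ?thesis
    unfolding matrix_mult_nth by (auto intro!: sum.cong)
qed

text \<open>With \<open>F\<close> the diagonal matrix of the characteristic vector of \<open>Y\<close>,
  the form below is the trace of \<open>P F Q F\<close>, which is the squared Frobenius norm of \<open>P F Q\<close>.\<close>

lemma principal_submatrix_mult_eq_0:
  fixes P Q :: "complex^'v::finite^'v"
  assumes P: "transpose P = P" "cnj_mat P = P" "P ** P = P"
    and Q: "transpose Q = Q" "cnj_mat Q = Q" "Q ** Q = Q"
    and zero: "char_form Y (hadamard P Q) = 0"
  shows "principal_submatrix Y P ** principal_submatrix Y Q = 0"
proof -
  have tr: "P $ a $ b = P $ b $ a" "Q $ a $ b = Q $ b $ a" for a b
    by (rule symmetric_nth[OF P(1)] symmetric_nth[OF Q(1)])+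
  have re: "cnj (P $ a $ b) = P $ a $ b" "cnj (Q $ a $ b) = Q $ a $ b" for a b
    using P Q by (metis cnj_mat_nth)+
  \<comment> \<open>The entry of \<open>P F Q\<close> at \<open>(a, b)\<close>, with
    \<open>a\<close> and \<open>b\<close> ranging over all vertices; the product in the conclusion
    consists of the entries with \<open>a\<close> and \<open>b\<close> in \<open>Y\<close>.\<close>
  define g where "g a b = (\<Sum>z\<in>Y. P $ a $ z * Q $ z $ b)" for a b
  have PP: "P $ z $ z' = (\<Sum>a\<in>UNIV. P $ a $ z * P $ a $ z')" for z z'
    by (subst P(3)[symmetric], unfold matrix_mult_nth) (simp add: tr[of z])
  have QQ: "Q $ z $ z' = (\<Sum>b\<in>UNIV. Q $ z $ b * Q $ z' $ b)" for z z'
    by (subst Q(3)[symmetric], unfold matrix_mult_nth) (simp add: tr(2)[of _ z'])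
  let ?t = "\<lambda>a b z z'. P $ a $ z * Q $ z $ b * (P $ a $ z' * Q $ z' $ b)"
  have "char_form Y (hadamard P Q) = (\<Sum>z\<in>Y. \<Sum>z'\<in>Y. \<Sum>a\<in>UNIV. \<Sum>b\<in>UNIV. ?t a b z z')"
    unfolding char_form_eq
  proof (intro sum.cong refl)
    fix z z'
    have "hadamard P Q $ z $ z' =
      (\<Sum>a\<in>UNIV. P $ a $ z * P $ a $ z') * (\<Sum>b\<in>UNIV. Q $ z $ b * Q $ z' $ b)"
      using PP[of z z'] QQ[of z z'] by simp
    then show "hadamard P Q $ z $ z' = (\<Sum>a\<in>UNIV. \<Sum>b\<in>UNIV. ?t a b z z')"
      unfolding sum_product by (simp only: mult_ac)
  qed
  also have "\<dots> = (\<Sum>z\<in>Y. \<Sum>a\<in>UNIV. \<Sum>z'\<in>Y. \<Sum>b\<in>UNIV. ?t a b z z')"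
    by (intro sum.cong refl sum.swap)
  also have "\<dots> = (\<Sum>a\<in>UNIV. \<Sum>z\<in>Y. \<Sum>z'\<in>Y. \<Sum>b\<in>UNIV. ?t a b z z')"
    by (rule sum.swap)
  also have "\<dots> = (\<Sum>a\<in>UNIV. \<Sum>z\<in>Y. \<Sum>b\<in>UNIV. \<Sum>z'\<in>Y. ?t a b z z')"
    by (intro sum.cong refl sum.swap)
  also have "\<dots> = (\<Sum>a\<in>UNIV. \<Sum>b\<in>UNIV. \<Sum>z\<in>Y. \<Sum>z'\<in>Y. ?t a b z z')"
    by (intro sum.cong refl sum.swap)
  also have "\<dots> = (\<Sum>a\<in>UNIV. \<Sum>b\<in>UNIV. g a b * cnj (g a b))"
    by (simp add: g_def sum_product re)
  also have "\<dots> = complex_of_real (\<Sum>a\<in>UNIV. \<Sum>b\<in>UNIV. (cmod (g a b))\<^sup>2)"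
    by (simp only: of_real_sum complex_norm_square)
  finally have "(\<Sum>a\<in>UNIV. \<Sum>b\<in>UNIV. (cmod (g a b))\<^sup>2) = 0"
    using zero by (metis of_real_eq_0_iff)
  then have "g a b = 0" for a b
    by (simp add: sum_nonneg_eq_0_iff sum_nonneg)
  then show ?thesis
    by (simp add: vec_eq_iff principal_submatrix_mult_nth g_def)
qed

section \<open>Distances\<close>

lemma relpow_sym:
  assumes "sym R" "(x, y) \<in> R ^^ n"
  shows "(y, x) \<in> R ^^ n"
  using assms(2)
proof (induction n arbitrary: y)
  case (Suc n)
  then obtain z where "(x, z) \<in> R ^^ n" "(z, y) \<in> R" by auto
  then have "(y, z) \<in> R" "(z, x) \<in> R ^^ n"
    using Suc.IH assms(1) by (auto dest: symD)
  then show ?case by (rule relpow_Suc_I2)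
qed simp

lemma graph_dist_commute: "sym R \<Longrightarrow> graph_dist R x y = graph_dist R y x"
  unfolding graph_dist_def by (rule arg_cong[where f = Least]) (auto intro!: ext relpow_sym)

lemma graph_dist_le: "(x, y) \<in> R ^^ n \<Longrightarrow> graph_dist R x y \<le> n"
  unfolding graph_dist_def by (rule Least_le)

lemma graph_dist_same [simp]: "graph_dist R x x = 0"
  using graph_dist_le[of x x 0 R] by simp

lemma relpow_graph_dist:
  assumes "connected_graph X R" "x \<in> X" "y \<in> X"
  shows "(x, y) \<in> R ^^ graph_dist R x y"
proof -
  have "\<exists>n. (x, y) \<in> R ^^ n"
    using assms rtrancl_imp_relpow by (fastforce simp: connected_graph_def)
  then show ?thesis
    unfolding graph_dist_def by (rule LeastI_ex)
qed

lemma graph_dist_eq_0_iff: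
  assumes "connected_graph X R" "x \<in> X" "y \<in> X"
  shows "graph_dist R x y = 0 \<longleftrightarrow> x = y"
  using relpow_graph_dist[OF assms] by auto

lemma graph_dist_step:
  assumes "connected_graph X R" "x \<in> X" "y \<in> X" "(y, z) \<in> R"
  shows "graph_dist R x z \<le> Suc (graph_dist R x y)"
  using relpow_graph_dist[OF assms(1-3)] assms(4) by (intro graph_dist_le) auto

lemma graph_dist_pred:
  assumes "connected_graph X R" "R \<subseteq> X \<times> X" "x \<in> X" "y \<in> X" "graph_dist R x y = Suc n"
  obtains z where "z \<in> X" "(z, y) \<in> R" "graph_dist R x z = n"
proof -
  obtain z where z: "(x, z) \<in> R ^^ n" "(z, y) \<in> R"
    using relpow_graph_dist[OF assms(1,3,4)] assms(5) by auto
  then have "z \<in> X" using assms(2) by auto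
  moreover have "graph_dist R x z = n"
    using graph_dist_le[OF z(1)] graph_dist_step[OF assms(1,3) \<open>z \<in> X\<close> z(2)] assms(5) by simp
  ultimately show ?thesis using that z by blast
qed

lemma graph_dist_eq_1_iff:
  assumes "connected_graph X R" "simple_graph X R" "x \<in> X" "y \<in> X"
  shows "graph_dist R x y = Suc 0 \<longleftrightarrow> (x, y) \<in> R"
proof
  assume "graph_dist R x y = Suc 0"
  then show "(x, y) \<in> R"
    using relpow_graph_dist[OF assms(1,3,4)] by simp
next
  assume xy: "(x, y) \<in> R"
  then have "graph_dist R x y \<le> Suc 0" by (intro graph_dist_le) simp
  moreover have "x \<noteq> y" using xy assms(2) by (auto simp: simple_graph_def irrefl_def)
  ultimately show "graph_dist R x y = Suc 0"
    using graph_dist_eq_0_iff[OF assms(1,3,4)] by linarith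
qed

lemma finite_graph_dists: "finite {graph_dist R x y | x y. x \<in> X \<and> y \<in> (X :: 'v::finite set)}"
  by (rule finite_subset[of _ "(\<lambda>(x, y). graph_dist R x y) ` UNIV"]) auto

lemma graph_dist_le_diam:
  fixes X :: "'v::finite set"
  shows "x \<in> X \<Longrightarrow> y \<in> X \<Longrightarrow> graph_dist R x y \<le> graph_diam X R"
  unfolding graph_diam_def by (intro Max_ge finite_graph_dists) auto

lemma graph_diam_attained:
  fixes X :: "'v::finite set"
  assumes "X \<noteq> {}"
  obtains x y where "x \<in> X" "y \<in> X" "graph_dist R x y = graph_diam X R"
proof -
  have "graph_diam X R \<in> {graph_dist R x y | x y. x \<in> X \<and> y \<in> X}"
    unfolding graph_diam_def by (intro Max_in finite_graph_dists) (use assms in auto)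
  then show ?thesis using that by auto
qed

text \<open>Along a walk, the distance from the starting point grows by at most one in each step.\<close>

lemma walk_crosses_level:
  assumes "connected_graph X R" "Q \<subseteq> R" "R \<subseteq> X \<times> X" "x \<in> X"
    and "(x, y) \<in> Q\<^sup>*" "Suc h \<le> graph_dist R x y"
  obtains u v where "(x, u) \<in> Q\<^sup>*" "(u, v) \<in> Q" "graph_dist R x u = h" "graph_dist R x v = Suc h"
proof -
  have "Suc h \<le> graph_dist R x y \<longrightarrow>
    (\<exists>u v. (x, u) \<in> Q\<^sup>* \<and> (u, v) \<in> Q \<and> graph_dist R x u = h \<and> graph_dist R x v = Suc h)"
    using assms(5)
  proof (induction rule: rtrancl_induct)
    case (step y z)
    have "graph_dist R x z \<le> Suc (graph_dist R x y)"
      by (rule graph_dist_step[OF assms(1,4)]) (use step assms in auto)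
    then consider "Suc h \<le> graph_dist R x y" | "graph_dist R x z \<le> h"
      | "graph_dist R x y = h" "graph_dist R x z = Suc h"
      by linarith
    then show ?case
      using step by cases auto
  qed simp
  then show ?thesis using that assms(6) by blast
qed

section \<open>The Bose--Mesner algebra\<close>

text \<open>Working form of span membership: the entries on \<open>Y\<close> are a function of the
  distance in \<open>R\<close>. It serves both the whole graph and a descendent, where
  \<open>R\<close> stays the ambient relation.\<close>

lemma in_span_dist_matrix_iff:
  fixes M :: "complex^'v::finite^'v"
  assumes bound: "\<And>x y. x \<in> Y \<Longrightarrow> y \<in> Y \<Longrightarrow> graph_dist R x y \<le> w"
  shows "M \<in> cmat.span (dist_matrix Y R ` {..w}) \<longleftrightarrow>
    (\<exists>f. \<forall>x y. M $ x $ y = (if x \<in> Y \<and> y \<in> Y then f (graph_dist R x y) else 0))"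
proof
  assume "M \<in> cmat.span (dist_matrix Y R ` {..w})"
  then obtain c where c: "M = (\<Sum>i\<in>{..w}. cmat_scale (c i) (dist_matrix Y R i))"
    by (rule span_image_eq_sum[rotated]) auto
  have "M $ x $ y = (if x \<in> Y \<and> y \<in> Y then c (graph_dist R x y) else 0)" for x y
    using bound[of x y]
    by (auto simp: c sum_nth2 if_distrib[of "\<lambda>t. _ * t"] cong: if_cong)
  then show "\<exists>f. \<forall>x y. M $ x $ y = (if x \<in> Y \<and> y \<in> Y then f (graph_dist R x y) else 0)"
    by blast
next
  assume "\<exists>f. \<forall>x y. M $ x $ y = (if x \<in> Y \<and> y \<in> Y then f (graph_dist R x y) else 0)"
  then obtain f where f: "\<And>x y. M $ x $ y = (if x \<in> Y \<and> y \<in> Y then f (graph_dist R x y) else 0)"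
    by blast
  have "M = (\<Sum>i\<in>{..w}. cmat_scale (f i) (dist_matrix Y R i))"
    using bound
    by (auto simp: vec_eq_iff f sum_nth2 if_distrib[of "\<lambda>t. _ * t"] cong: if_cong)
  then show "M \<in> cmat.span (dist_matrix Y R ` {..w})"
    by (metis (no_types, lifting) cmat.span_sum cmat.span_scale cmat.span_base imageI)
qed

lemma transpose_dist_matrix: "sym R \<Longrightarrow> transpose (dist_matrix X R i) = dist_matrix X R i"
  by (auto simp: vec_eq_iff transpose_def graph_dist_commute)

lemma cnj_mat_dist_matrix: "cnj_mat (dist_matrix X R i) = dist_matrix X R i"
  by (simp add: vec_eq_iff)

lemma dist_matrix_0_mult:
  assumes "connected_graph X R" "Y \<subseteq> X" "\<And>x y. M $ x $ y \<noteq> 0 \<Longrightarrow> x \<in> Y \<and> y \<in> Y"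
  shows "dist_matrix Y R 0 ** M = M" "M ** dist_matrix Y R 0 = (M :: complex^'v::finite^'v)"
proof -
  have D: "dist_matrix Y R 0 $ x $ y = (if x = y \<and> x \<in> Y then 1 else 0)" for x y
    using graph_dist_eq_0_iff[OF assms(1)] assms(2) by auto
  have "dist_matrix Y R 0 $ x $ z * M $ z $ y = (if z = x then M $ x $ y else 0)"
    "M $ x $ z * dist_matrix Y R 0 $ z $ y = (if z = y then M $ x $ y else 0)" for x y z
    unfolding D using assms(3) by auto
  then show "dist_matrix Y R 0 ** M = M" "M ** dist_matrix Y R 0 = M"
    by (simp_all only: vec_eq_iff matrix_mult_nth sum.delta finite if_True UNIV_I simp_thms)
qed

lemma dist_matrix_mult_adjacency:
  fixes X :: "'v::finite set"
  assumes "connected_graph X R" "simple_graph X R" and Y: "Y \<subseteq> X" "x \<in> Y" "y \<in> Y"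
  shows "(dist_matrix Y R i ** dist_matrix Y R 1) $ x $ y =
    of_nat (card {z \<in> Y. (y, z) \<in> R \<and> graph_dist R x z = i})"
proof -
  have sym: "sym R" using assms(2) by (simp add: simple_graph_def)
  have "(dist_matrix Y R i ** dist_matrix Y R 1) $ x $ y =
    (\<Sum>z\<in>UNIV. if z \<in> {z \<in> Y. (y, z) \<in> R \<and> graph_dist R x z = i} then 1 else 0)"
    unfolding matrix_mult_nth
  proof (intro sum.cong refl)
    fix z
    have "graph_dist R z y = 1 \<longleftrightarrow> (y, z) \<in> R" if "z \<in> Y"
      using graph_dist_eq_1_iff[OF assms(1,2), of y z] that Y graph_dist_commute[OF sym, of z y] by auto
    then show "dist_matrix Y R i $ x $ z * dist_matrix Y R 1 $ z $ y =
        (if z \<in> {z \<in> Y. (y, z) \<in> R \<and> graph_dist R x z = i} then 1 else 0)"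
      using Y by auto
  qed
  also have "\<dots> = (\<Sum>z\<in>{z \<in> Y. (y, z) \<in> R \<and> graph_dist R x z = i}. 1)"
    by (rule sum.mono_neutral_cong_right) auto
  finally show ?thesis by simp
qed

lemma distance_regular_neighbour_counts:
  fixes X :: "'v::finite set"
  assumes dr: "distance_regular X R"
  obtains p where "\<And>i x y. x \<in> X \<Longrightarrow> y \<in> X \<Longrightarrow>
    card {z. (y, z) \<in> R \<and> graph_dist R x z = i} = p i (graph_dist R x y)"
proof -
  have con: "connected_graph X R" and sg: "simple_graph X R"
    using dr by (auto simp: distance_regular_def)
  have RX: "R \<subseteq> X \<times> X" and sym: "sym R" using sg by (auto simp: simple_graph_def)
  obtain b c where bc: "\<And>x y. x \<in> X \<Longrightarrow> y \<in> X \<Longrightarrow>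
        card {z. (y, z) \<in> R \<and> graph_dist R x z = graph_dist R x y + 1} = b (graph_dist R x y) \<and>
        card {z. (y, z) \<in> R \<and> graph_dist R x z + 1 = graph_dist R x y} = (c (graph_dist R x y) :: nat)"
    using dr unfolding distance_regular_def by blast
  \<comment> \<open>\<open>b 0\<close> is the valency, and all neighbours of \<open>y\<close> lie at
    distance \<open>h - 1\<close>, \<open>h\<close> or \<open>h + 1\<close> from \<open>x\<close>,
    so the middle count is what remains. The test \<open>i + 1 = h\<close> instead of
    \<open>i = h - 1\<close> keeps \<open>h = 0\<close> correct under truncated subtraction.\<close>
  define p where "p i h = (if i = h + 1 then b h else if i + 1 = h then c h
    else if i = h then b 0 - b h - c h else 0)" for i h :: nat
  have "card {z. (y, z) \<in> R \<and> graph_dist R x z = i} = p i (graph_dist R x y)"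
    if xy: "x \<in> X" "y \<in> X" for i x y
  proof -
    let ?h = "graph_dist R x y"
    let ?N = "\<lambda>i. {z. (y, z) \<in> R \<and> graph_dist R x z = i}"
    have near: "graph_dist R x z \<le> Suc ?h" "?h \<le> Suc (graph_dist R x z)" if "(y, z) \<in> R" for z
    proof -
      have "(z, y) \<in> R" "z \<in> X" using that sym RX by (auto dest: symD)
      then show "graph_dist R x z \<le> Suc ?h" "?h \<le> Suc (graph_dist R x z)"
        using graph_dist_step[OF con xy that] graph_dist_step[OF con xy(1), of z y] by auto
    qed
    have "{z. (y, z) \<in> R} = {z. (y, z) \<in> R \<and> graph_dist R y z = graph_dist R y y + 1}"
      using graph_dist_eq_1_iff[OF con sg xy(2)] RX by auto
    then have valency: "card {z. (y, z) \<in> R} = b 0"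
      using bc[OF xy(2,2)] by simp
    have "{z. (y, z) \<in> R} = ?N ?h \<union> ?N (?h + 1) \<union> {z. (y, z) \<in> R \<and> graph_dist R x z + 1 = ?h}"
      using near by (force simp: le_Suc_eq)
    then have "b 0 = card (?N ?h \<union> ?N (?h + 1) \<union> {z. (y, z) \<in> R \<and> graph_dist R x z + 1 = ?h})"
      using valency by simp
    also have "\<dots> = card (?N ?h) + b ?h + c ?h"
      using bc[OF xy] by (subst card_Un_disjoint, simp, simp, force)+ simp
    finally have "card (?N ?h) = b 0 - b ?h - c ?h" by simp
    moreover have "?N i = {}" if "i \<noteq> ?h" "i \<noteq> ?h + 1" "i + 1 \<noteq> ?h"
      using near that by (force simp: le_Suc_eq)
    moreover have "?N i = {z. (y, z) \<in> R \<and> graph_dist R x z + 1 = ?h}" if "i + 1 = ?h"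
      using that by auto
    ultimately show ?thesis
      using bc[OF xy] by (auto simp: p_def)
  qed
  then show ?thesis using that by blast
qed

section \<open>Closure of the Bose-Mesner algebra under multiplication\<close>

context
  fixes X :: "'v::finite set" and R
  assumes dr: "distance_regular X R"
begin

lemma dr_graph: "connected_graph X R" "simple_graph X R" "R \<subseteq> X \<times> X" "sym R"
  using dr by (auto simp: distance_regular_def simple_graph_def)

lemma in_bose_mesner_iff:
  "M \<in> bose_mesner X R \<longleftrightarrow>
    (\<exists>f. \<forall>x y. M $ x $ y = (if x \<in> X \<and> y \<in> X then f (graph_dist R x y) else 0))"
  unfolding bose_mesner_def by (rule in_span_dist_matrix_iff) (rule graph_dist_le_diam)

lemma bose_mesner_subspace: "cmat.subspace (bose_mesner X R)"
  unfolding bose_mesner_def by (rule cmat.subspace_span)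

lemma dist_matrix_in_bose_mesner: "dist_matrix X R i \<in> bose_mesner X R"
  unfolding in_bose_mesner_iff by (rule exI[of _ "\<lambda>h. if h = i then 1 else 0"]) auto

lemma bose_mesner_symmetric: "M \<in> bose_mesner X R \<Longrightarrow> transpose M = M"
  unfolding bose_mesner_def
  by (rule symmetric_span) (auto simp: transpose_dist_matrix dr_graph)

lemma bose_mesner_cnj_mat: "M \<in> bose_mesner X R \<Longrightarrow> cnj_mat M \<in> bose_mesner X R"
  unfolding bose_mesner_def
  by (rule cnj_mat_span) (auto simp: cnj_mat_dist_matrix)

text \<open>Counting neighbours of the second vertex handles the adjacency matrix as right factor.
  That product is symmetric, as are both factors, so transposing it swaps the order.\<close>

lemma bose_mesner_mult_adjacency:
  assumes "M \<in> bose_mesner X R"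
  shows "dist_matrix X R 1 ** M \<in> bose_mesner X R"
proof -
  obtain p where p: "\<And>i x y. x \<in> X \<Longrightarrow> y \<in> X \<Longrightarrow>
    card {z. (y, z) \<in> R \<and> graph_dist R x z = i} = p i (graph_dist R x y)"
    using distance_regular_neighbour_counts[OF dr] by blast
  have "dist_matrix X R i ** dist_matrix X R 1 \<in> bose_mesner X R" for i
    unfolding in_bose_mesner_iff
  proof (intro exI allI)
    fix x y
    have N: "{z \<in> X. (y, z) \<in> R \<and> graph_dist R x z = i} = {z. (y, z) \<in> R \<and> graph_dist R x z = i}"
      using dr_graph(3) by auto
    show "(dist_matrix X R i ** dist_matrix X R 1) $ x $ y =
        (if x \<in> X \<and> y \<in> X then of_nat (p i (graph_dist R x y)) else 0)"
    proof (cases "x \<in> X \<and> y \<in> X")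
      case True
      then show ?thesis
        by (simp only: p dist_matrix_mult_adjacency[OF dr_graph(1,2) subset_refl] N simp_thms if_True)
    next
      case False
      then have "dist_matrix X R i $ x $ z * dist_matrix X R 1 $ z $ y = 0" for z
        by auto
      then show ?thesis
        using False by (simp only: matrix_mult_nth sum.neutral_const if_False)
    qed
  qed
  then have MA: "M ** dist_matrix X R 1 \<in> bose_mesner X R"
    using assms unfolding bose_mesner_def
    by (elim matrix_mult_span_left[rotated]) auto
  then show ?thesis
    using bose_mesner_symmetric[OF MA]
      transpose_mult_symmetric[OF bose_mesner_symmetric[OF assms]
        bose_mesner_symmetric[OF dist_matrix_in_bose_mesner], of 1]
    by simp
qed

text \<open>Strong induction: the product of the \<open>j\<close>-th distance matrix with the
  adjacency matrix is a multiple of the next distance matrix plus a combination of those up to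
  \<open>j\<close>. Solving for the next one and multiplying by \<open>M\<close> leaves only
  products covered by the induction hypothesis.\<close>

lemma dist_matrix_mult_bose_mesner:
  "M \<in> bose_mesner X R \<Longrightarrow> dist_matrix X R i ** M \<in> bose_mesner X R"
proof (induction i arbitrary: M rule: less_induct)
  case (less i)
  show ?case
  proof (cases i)
    case 0
    have "dist_matrix X R 0 ** M = M"
      by (rule dist_matrix_0_mult[OF dr_graph(1) subset_refl])
        (use less.prems in_bose_mesner_iff in \<open>auto split: if_splits\<close>)
    then show ?thesis using 0 less.prems by simp
  next
    case (Suc j)
    let ?A = "dist_matrix X R"
    have "?A 1 ** ?A j \<in> bose_mesner X R"
      by (rule bose_mesner_mult_adjacency) (rule dist_matrix_in_bose_mesner)
    moreover from this have "?A 1 ** ?A j = ?A j ** ?A 1"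
      using bose_mesner_symmetric
        transpose_mult_symmetric[OF bose_mesner_symmetric[OF dist_matrix_in_bose_mesner]
          bose_mesner_symmetric[OF dist_matrix_in_bose_mesner], of 1 j]
      by simp
    ultimately have "?A j ** ?A 1 \<in> bose_mesner X R"
      by simp
    then obtain f where
      f: "\<And>x y. (?A j ** ?A 1) $ x $ y = (if x \<in> X \<and> y \<in> X then f (graph_dist R x y) else 0)"
      unfolding in_bose_mesner_iff by blast
    show ?thesis
    proof (cases "\<exists>x\<in>X. \<exists>y\<in>X. graph_dist R x y = Suc j")
      case False
      then have "?A i = 0" using Suc by (auto simp: vec_eq_iff)
      then show ?thesis
        using cmat.subspace_0[OF bose_mesner_subspace] by simp
    next
      case True
      then obtain x y where xy: "x \<in> X" "y \<in> X" "graph_dist R x y = Suc j" by blast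
      obtain z where z: "z \<in> X" "(z, y) \<in> R" "graph_dist R x z = j"
        using graph_dist_pred[OF dr_graph(1,3) xy] by blast
      \<comment> \<open>This coefficient counts neighbours of \<open>y\<close> at distance
        \<open>j\<close> from \<open>x\<close>; the last vertex before \<open>y\<close> on a
        geodesic is one of them.\<close>
      have nz: "f (Suc j) \<noteq> 0"
      proof
        assume "f (Suc j) = 0"
        then have "card {z \<in> X. (y, z) \<in> R \<and> graph_dist R x z = j} = 0"
          using f[of x y] dist_matrix_mult_adjacency[OF dr_graph(1,2) subset_refl xy(1,2), of j] xy by simp
        then show False using z dr_graph(4) by (auto dest: symD)
      qed
      have far: "f (graph_dist R x y) = 0" if "x \<in> X" "y \<in> X" "Suc j < graph_dist R x y" for x y
      proof -
        have "graph_dist R x z \<noteq> j" if "z \<in> X" "(y, z) \<in> R" for z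
          using graph_dist_step[OF dr_graph(1) \<open>x \<in> X\<close> \<open>z \<in> X\<close>, of y] \<open>Suc j < graph_dist R x y\<close>
            symD[OF dr_graph(4) that(2)] by auto
        then have "{z \<in> X. (y, z) \<in> R \<and> graph_dist R x z = j} = {}" by auto
        then show ?thesis
          using f[of x y] dist_matrix_mult_adjacency[OF dr_graph(1,2) subset_refl that(1,2), of j] that
          by simp
      qed
      have "?A j ** ?A 1 = cmat_scale (f (Suc j)) (?A (Suc j)) + (\<Sum>h\<in>{..j}. cmat_scale (f h) (?A h))"
        unfolding vec_eq_iff
      proof (intro allI)
        fix x y
        consider "graph_dist R x y \<le> j" | "graph_dist R x y = Suc j" | "Suc j < graph_dist R x y"
          by linarith
        then show "(?A j ** ?A 1) $ x $ y =
          (cmat_scale (f (Suc j)) (?A (Suc j)) + (\<Sum>h\<in>{..j}. cmat_scale (f h) (?A h))) $ x $ y"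
          unfolding f
          by cases (auto simp: far sum_nth2 if_distrib[of "\<lambda>t. _ * t"] cong: if_cong)
      qed
      then have "cmat_scale (f (Suc j)) (?A i) ** M =
          ?A j ** (?A 1 ** M) - (\<Sum>h\<in>{..j}. cmat_scale (f h) (?A h ** M))"
        unfolding Suc matrix_mul_assoc
        by (simp add: matrix_add_rdistrib sum_matrix_mult scale_matrix_mult)
      also have "\<dots> \<in> bose_mesner X R"
        using Suc less
        by (intro cmat.subspace_diff[OF bose_mesner_subspace] cmat.subspace_sum[OF bose_mesner_subspace]
            cmat.subspace_scale[OF bose_mesner_subspace] less.IH bose_mesner_mult_adjacency) auto
      finally have "cmat_scale (1 / f (Suc j)) (cmat_scale (f (Suc j)) (?A i) ** M) \<in> bose_mesner X R"
        by (rule cmat.subspace_scale[OF bose_mesner_subspace])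
      then show ?thesis
        using nz by (simp add: scale_matrix_mult)
    qed
  qed
qed

lemma bose_mesner_mult:
  assumes "M \<in> bose_mesner X R" "N \<in> bose_mesner X R"
  shows "M ** N \<in> bose_mesner X R"
  unfolding bose_mesner_def
  by (rule matrix_mult_span_left)
    (use assms dist_matrix_mult_bose_mesner in \<open>auto simp: bose_mesner_def\<close>)

lemma bose_mesner_primitive_idempotent:
  assumes "primitive_idempotent (bose_mesner X R) P"
  shows "transpose P = P" "cnj_mat P = P" "P ** P = P"
  using primitive_idempotent_real[OF bose_mesner_subspace bose_mesner_mult bose_mesner_symmetric
      bose_mesner_cnj_mat assms] assms bose_mesner_symmetric
  by (auto simp: primitive_idempotent_def)

end

section \<open>Entrywise products and triangular pairings\<close>

lemma hadamard_add_right: "hadamard L (M + N) = hadamard L M + hadamard L N"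
  by (simp add: vec_eq_iff distrib_left)

lemma hadamard_add_left: "hadamard (M + N) L = hadamard M L + hadamard N L"
  by (simp add: vec_eq_iff distrib_right)

lemma hadamard_scale_right: "hadamard L (cmat_scale a M) = cmat_scale a (hadamard L M)"
  by (simp add: vec_eq_iff)

lemma hadamard_scale_left: "hadamard (cmat_scale a M) L = cmat_scale a (hadamard M L)"
  by (simp add: vec_eq_iff)

lemma hadamard_0 [simp]: "hadamard L 0 = 0" "hadamard 0 L = 0"
  by (simp_all add: vec_eq_iff)

lemma hadamard_assoc: "hadamard (hadamard L M) N = hadamard L (hadamard M N)"
  by (simp add: vec_eq_iff mult.assoc)

lemma hadamard_commute: "hadamard M N = hadamard N M"
  by (simp add: vec_eq_iff mult.commute)

lemma hadamard_span:
  assumes "\<And>B. B \<in> S \<Longrightarrow> hadamard L B \<in> cmat.span T" and "M \<in> cmat.span S"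
  shows "hadamard L M \<in> cmat.span T"
  using assms(2)
  by (induction rule: cmat.span_induct_alt)
    (auto simp: assms(1) hadamard_add_right hadamard_scale_right
      cmat.span_zero cmat.span_add cmat.span_scale)

lemma char_form_hadamard_principal_submatrix:
  "char_form Y (hadamard (principal_submatrix Y M) N) = char_form Y (hadamard M N)"
  unfolding char_form_eq by (intro sum.cong refl) auto

lemma char_form_hadamard_sum:
  "char_form Y (hadamard (\<Sum>i\<in>I. cmat_scale (c i) (f i)) N) =
    (\<Sum>i\<in>I. c i * char_form Y (hadamard (f i) N))"
  by (induction I rule: infinite_finite_induct)
    (auto simp: hadamard_add_left hadamard_scale_left char_form_add char_form_scale)

text \<open>In a linear relation, pair with \<open>g j\<close> for the index \<open>j\<close> of
  largest rank whose coefficient is nonzero: only the diagonal term survives. The rank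
  \<open>r\<close> allows the order of the indices to be reversed.\<close>

lemma indep_family_triangular:
  fixes r :: "'i \<Rightarrow> nat"
  assumes fin: "finite I" and inj: "inj_on r I"
    and diag: "\<And>j. j \<in> I \<Longrightarrow> char_form Y (hadamard (f j) (g j)) \<noteq> 0"
    and tri: "\<And>i j. i \<in> I \<Longrightarrow> j \<in> I \<Longrightarrow> r i < r j \<Longrightarrow> char_form Y (hadamard (f i) (g j)) = 0"
  shows "indep_family f I"
  unfolding indep_family_def
proof (intro allI impI ballI, rule ccontr)
  fix c k assume z: "(\<Sum>i\<in>I. cmat_scale (c i) (f i)) = 0" and k: "k \<in> I" "c k \<noteq> 0"
  let ?S = "{i \<in> I. c i \<noteq> 0}"
  have "Max (r ` ?S) \<in> r ` ?S"
    by (rule Max_in) (use fin k in auto)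
  then obtain j where j: "j \<in> I" "c j \<noteq> 0" and max: "r j = Max (r ` ?S)"
    by auto
  have above: "c i = 0" if "i \<in> I" "r j < r i" for i
  proof (rule ccontr)
    assume "c i \<noteq> 0"
    then have "r i \<le> Max (r ` ?S)" by (intro Max_ge) (use fin that in auto)
    then show False using that max by simp
  qed
  have "0 = (\<Sum>i\<in>I. c i * char_form Y (hadamard (f i) (g j)))"
    using z by (simp flip: char_form_hadamard_sum)
  also have "\<dots> = (\<Sum>i\<in>I. if i = j then c j * char_form Y (hadamard (f j) (g j)) else 0)"
  proof (intro sum.cong refl)
    fix i assume i: "i \<in> I"
    then consider "r i < r j" | "i = j" | "r j < r i"
      using inj j by (metis inj_onD linorder_neqE_nat)
    then show "c i * char_form Y (hadamard (f i) (g j)) =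
        (if i = j then c j * char_form Y (hadamard (f j) (g j)) else 0)"
      using i j tri above by cases auto
  qed
  also have "\<dots> = c j * char_form Y (hadamard (f j) (g j))"
    using fin j by simp
  finally show False using diag j by simp
qed

section \<open>Products of idempotents in a \<open>Q\<close>-polynomial graph\<close>

text \<open>Induction on \<open>i\<close>, solving the recurrence for \<open>E i\<close> and
  multiplying entrywise by \<open>E j\<close>. Each product with \<open>E 1\<close> lowers the least
  index by at most one, and its lowest coefficient is controlled by \<open>b\<close>. Only this
  lower end matters, so the tail may run up to the diameter.\<close>

lemma q_polynomial_hadamard:
  fixes X :: "'v::finite set"
  assumes dr: "distance_regular X R" and q: "q_polynomial X R E" and d: "1 \<le> graph_diam X R"
    and ij: "i \<le> j" "j \<le> graph_diam X R"
  shows "\<exists>q N. q \<noteq> 0 \<and> N \<in> cmat.span (E ` {j - i<..graph_diam X R}) \<and>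
    hadamard (E i) (E j) = cmat_scale q (E (j - i)) + N"
proof -
  define d where "d = graph_diam X R"
  define n :: complex where "n = 1 / of_nat (card X)"
  have "X \<noteq> {}" using dr by (simp add: distance_regular_def connected_graph_def)
  then have n0: "n \<noteq> 0" by (simp add: n_def card_gt_0_iff)
  have d1: "1 \<le> d" using d by (simp add: d_def)
  have E0: "E 0 = cmat_scale n (all_ones X)" and
    prim: "bij_betw E {..d} {P. primitive_idempotent (bose_mesner X R) P}"
    using q by (simp_all add: q_polynomial_def Let_def n_def d_def)
  from q obtain a' b' c' where bc': "\<And>i. i \<in> {1..d} \<Longrightarrow> b' (i - 1) * c' i \<noteq> 0"
    and rec': "\<And>i. i \<le> d \<Longrightarrow> hadamard (E 1) (E i) =
              cmat_scale n
                ((if i = 0 then 0 else cmat_scale (b' (i - 1)) (E (i - 1)))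
                 + cmat_scale (a' i) (E i)
                 + (if i = d then 0 else cmat_scale (c' (i + 1)) (E (i + 1))))"
    unfolding q_polynomial_def Let_def n_def d_def by blast
  define a b c where "a i = n * a' i" and "b i = n * b' i" and "c i = n * c' i" for i
  have b0: "b (i - 1) \<noteq> 0" and c0: "c i \<noteq> 0" if "i \<in> {1..d}" for i
    using bc'[OF that] n0 by (auto simp: b_def c_def)
  have rec: "hadamard (E 1) (E i) = (if i = 0 then 0 else cmat_scale (b (i - 1)) (E (i - 1)))
      + cmat_scale (a i) (E i) + (if i = d then 0 else cmat_scale (c (i + 1)) (E (i + 1)))"
    if "i \<le> d" for i
    using rec'[OF that] by (simp add: a_def b_def c_def cmat.scale_right_distrib)
  define S where "S k = cmat.span (E ` {k..d})" for k
  have S_mono: "S k \<subseteq> S l" if "l \<le> k" for k l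
    unfolding S_def using that by (intro cmat.span_mono) auto
  have S_add: "M + N \<in> S k" and S_diff: "M - N \<in> S k" and S_scale: "cmat_scale t M \<in> S k"
    if "M \<in> S k" "N \<in> S k" for M N k t
    using that by (auto simp: S_def cmat.span_add cmat.span_diff cmat.span_scale)
  have S_base: "E h \<in> S k" if "k \<le> h" "h \<le> d" for h k
    using that by (auto simp: S_def intro: cmat.span_base)
  have S_0: "0 \<in> S k" for k by (simp add: S_def cmat.span_zero)
  have E1_S: "hadamard (E 1) M \<in> S m" if "M \<in> S (Suc m)" for M m
    using that unfolding S_def
  proof (rule hadamard_span[rotated])
    fix B assume "B \<in> E ` {Suc m..d}"
    then obtain h where h: "B = E h" "Suc m \<le> h" "h \<le> d" by auto
    have "hadamard (E 1) (E h) \<in> S m"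
      unfolding rec[OF h(3)] using h
      by (auto intro!: S_add S_scale S_base S_0)
    then show "hadamard (E 1) B \<in> cmat.span (E ` {m..d})"
      by (simp add: h S_def)
  qed
  have "\<exists>q N. q \<noteq> 0 \<and> N \<in> S (Suc (j - i)) \<and> hadamard (E i) (E j) = cmat_scale q (E (j - i)) + N"
    if "i \<le> j" "j \<le> d" for i j
    using that
  proof (induction i rule: less_induct)
    case (less i)
    show ?case
    proof (cases i)
      case 0
      have "E j \<in> bose_mesner X R"
        using prim less.prems by (auto simp: bij_betw_def primitive_idempotent_def)
      then have "E j $ x $ y = 0" if "\<not> (x \<in> X \<and> y \<in> X)" for x y
        using that in_bose_mesner_iff[OF dr] by auto
      then have "hadamard (E 0) (E j) = cmat_scale n (E j)"
        by (auto simp: E0 vec_eq_iff all_ones_def)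
      then show ?thesis
        using 0 n0 S_0 by (intro exI[of _ n] exI[of _ 0]) auto
    next
      case (Suc l)
      let ?m = "j - l"
      have m: "1 \<le> ?m" "?m \<le> d" "j - i = ?m - 1" "Suc (?m - 1) = ?m" using Suc less.prems by auto
      have l: "l < d" "Suc l \<in> {1..d}" using Suc less.prems by auto
      obtain q N where q: "q \<noteq> 0" and N: "N \<in> S (Suc ?m)"
        and EE: "hadamard (E l) (E j) = cmat_scale q (E ?m) + N"
        using less.IH[of l] Suc less.prems by auto
      have EE_in: "hadamard (E l) (E j) \<in> S ?m"
        unfolding EE using m N S_mono[of ?m "Suc ?m"] by (auto intro!: S_add S_scale S_base)
      \<comment> \<open>The term with \<open>E (l - 1)\<close> has least index
        \<open>?m + 1\<close>, so it cannot disturb the leading term at \<open>?m - 1\<close>; for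
        \<open>l = 0\<close> it is absent.\<close>
      have prev_in: "(if l = 0 then 0 else cmat_scale (b (l - 1)) (hadamard (E (l - 1)) (E j))) \<in> S ?m"
      proof (cases l)
        case (Suc k)
        obtain q' N' where N': "N' \<in> S (Suc (j - k))"
          "hadamard (E k) (E j) = cmat_scale q' (E (j - k)) + N'"
          using less.IH[of k] \<open>i = Suc l\<close> Suc less.prems by auto
        have "N' \<in> S ?m"
          by (rule subsetD[OF S_mono N'(1)]) (use Suc in simp)
        then have "hadamard (E k) (E j) \<in> S ?m"
          using Suc less.prems m unfolding N'(2) by (auto intro!: S_add S_scale S_base)
        then show ?thesis using Suc by (auto intro: S_scale)
      qed (simp add: S_0)
      have "hadamard (E 1) (hadamard (E l) (E j)) = hadamard (hadamard (E 1) (E l)) (E j)"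
        by (simp add: hadamard_assoc)
      also have "\<dots> = (if l = 0 then 0 else cmat_scale (b (l - 1)) (hadamard (E (l - 1)) (E j))) +
          cmat_scale (a l) (hadamard (E l) (E j)) + cmat_scale (c i) (hadamard (E i) (E j))"
        using rec[of l] l Suc by (auto simp: hadamard_add_left hadamard_scale_left)
      finally have 1: "cmat_scale (c i) (hadamard (E i) (E j)) =
          hadamard (E 1) (hadamard (E l) (E j)) -
          ((if l = 0 then 0 else cmat_scale (b (l - 1)) (hadamard (E (l - 1)) (E j))) +
          cmat_scale (a l) (hadamard (E l) (E j)))"
        by (simp add: algebra_simps)
      \<comment> \<open>Only \<open>E ?m\<close> contributes to \<open>E (?m - 1)\<close>, with
        factor \<open>b (?m - 1)\<close>, nonzero because \<open>?m\<close> is at least 1. As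
        \<open>N\<close> starts at index \<open>?m + 1\<close>, its product with \<open>E 1\<close>
        starts no lower than \<open>?m\<close>.\<close>
      define N1 where "N1 = cmat_scale q (cmat_scale (a ?m) (E ?m)
          + (if ?m = d then 0 else cmat_scale (c (?m + 1)) (E (?m + 1)))) + hadamard (E 1) N"
      have "hadamard (E 1) (hadamard (E l) (E j)) = cmat_scale (q * b (?m - 1)) (E (?m - 1)) + N1"
        unfolding EE N1_def hadamard_add_right hadamard_scale_right rec[OF m(2)]
        using m by (simp add: cmat.scale_right_distrib)
      moreover have "N1 \<in> S ?m"
        unfolding N1_def using m E1_S[OF N] by (auto intro!: S_add S_scale S_base S_0)
      ultimately obtain N2 where N2: "N2 \<in> S ?m"
        and 2: "cmat_scale (c i) (hadamard (E i) (E j)) = cmat_scale (q * b (?m - 1)) (E (?m - 1)) + N2"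
        using 1 S_diff[OF _ S_add[OF prev_in S_scale[OF EE_in EE_in]], of N1 "a l"]
        by (metis (no_types, lifting) add_diff_eq)
      have ci: "c i \<noteq> 0" using c0[OF l(2)] Suc by simp
      have "hadamard (E i) (E j) = cmat_scale (1 / c i) (cmat_scale (c i) (hadamard (E i) (E j)))"
        using ci by simp
      also have "\<dots> = cmat_scale (q * b (?m - 1) / c i) (E (?m - 1)) + cmat_scale (1 / c i) N2"
        unfolding 2 by (simp add: cmat.scale_right_distrib)
      finally have "hadamard (E i) (E j) =
        cmat_scale (q * b (?m - 1) / c i) (E (?m - 1)) + cmat_scale (1 / c i) N2" .
      moreover have "q * b (?m - 1) / c i \<noteq> 0" using q ci b0[of ?m] m by auto
      moreover have "cmat_scale (1 / c i) N2 \<in> S ?m" using S_scale N2 by blast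
      ultimately show ?thesis using m by metis
    qed
  qed
  then show ?thesis
    using ij unfolding S_def d_def by (simp add: atLeastSucAtMost_greaterThanAtMost)
qed

section \<open>Subsets of minimal width and dual width\<close>

locale q_polynomial_descendent =
  fixes X :: "'v::finite set" and R E Y
  assumes dr: "distance_regular X R" and qpoly: "q_polynomial X R E"
    and diam_pos: "1 \<le> graph_diam X R" and desc: "descendent X R E Y"
begin

abbreviation "d \<equiv> graph_diam X R"
abbreviation "w \<equiv> width X R Y"
abbreviation "s \<equiv> dual_width X R E Y"
text \<open>The distance here is that of the ambient graph; agreement with the distance inside
  \<open>Y\<close> is itself a consequence of the closure of this span under products.\<close>

abbreviation "BY \<equiv> cmat.span (dist_matrix Y R ` {..w})"
abbreviation "e j \<equiv> principal_submatrix Y (E j)"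
text \<open>For \<open>k \<le> w + 1\<close>, \<open>L k\<close> has \<open>k\<close> generators and
  \<open>T k\<close> has \<open>w + 1 - k\<close>; the gap of \<open>s\<close> indices between them
  is what makes their products vanish.\<close>

abbreviation "L k \<equiv> cmat.span (e ` {..<k})"
abbreviation "T k \<equiv> cmat.span (e ` {s + k..d})"

lemmas con = dr_graph(1)[OF dr] and sg = dr_graph(2)[OF dr]
  and RX = dr_graph(3)[OF dr] and symR = dr_graph(4)[OF dr]

lemma Y: "Y \<noteq> {}" "Y \<subseteq> X" "w + s = d"
  using desc by (auto simp: descendent_def)

lemma E_primitive: "j \<le> d \<Longrightarrow> primitive_idempotent (bose_mesner X R) (E j)"
  using qpoly by (auto simp: q_polynomial_def Let_def bij_betw_def)

lemmas E_sym = bose_mesner_primitive_idempotent(1)[OF dr E_primitive]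
  and E_real = bose_mesner_primitive_idempotent(2)[OF dr E_primitive]
  and E_idem = bose_mesner_primitive_idempotent(3)[OF dr E_primitive]

lemma e_sym: "j \<le> d \<Longrightarrow> transpose (e j) = e j"
  using symmetric_nth[OF E_sym] by (auto simp: vec_eq_iff transpose_def)

lemma e_real: "j \<le> d \<Longrightarrow> cnj_mat (e j) = e j"
  using E_real by (auto simp: vec_eq_iff)

text \<open>Ensures that the maximum defining the dual width is taken over a nonempty set.\<close>

lemma char_form_E0:
  assumes "Z \<subseteq> X" "Z \<noteq> {}"
  shows "char_form Z (E 0) \<noteq> 0"
proof -
  have E0: "E 0 = cmat_scale (1 / of_nat (card X)) (all_ones X)"
    using qpoly by (simp add: q_polynomial_def Let_def)
  have "char_form Z (all_ones X) = (\<Sum>x\<in>Z. \<Sum>y\<in>Z. 1)"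
    unfolding char_form_eq all_ones_def using assms by (intro sum.cong refl) auto
  then show ?thesis
    using assms by (auto simp: E0 char_form_scale card_eq_0_iff)
qed

lemma dual_width_props:
  assumes "Z \<subseteq> X" "Z \<noteq> {}"
  shows "dual_width X R E Z \<le> d" "char_form Z (E (dual_width X R E Z)) \<noteq> 0"
    "\<And>h. dual_width X R E Z < h \<Longrightarrow> h \<le> d \<Longrightarrow> char_form Z (E h) = 0"
proof -
  let ?S = "{i. i \<le> d \<and> char_form Z (E i) \<noteq> 0}"
  have fin: "finite ?S" by simp
  have "Max ?S \<in> ?S"
    by (rule Max_in) (use fin char_form_E0[OF assms] in auto)
  then show "dual_width X R E Z \<le> d" "char_form Z (E (dual_width X R E Z)) \<noteq> 0"
    unfolding dual_width_def by auto
  show "char_form Z (E h) = 0" if "dual_width X R E Z < h" "h \<le> d" for h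
    using Max_ge[OF fin, of h] that unfolding dual_width_def by fastforce
qed

lemma width_props:
  shows "\<And>x y. x \<in> Y \<Longrightarrow> y \<in> Y \<Longrightarrow> graph_dist R x y \<le> w"
    and "\<exists>x\<in>Y. \<exists>y\<in>Y. graph_dist R x y = w"
proof -
  let ?S = "{i. i \<le> d \<and> char_form Y (dist_matrix X R i) \<noteq> 0}"
  have fin: "finite ?S" by simp
  have in_S: "graph_dist R x y \<in> ?S" if "x \<in> Y" "y \<in> Y" for x y
    using that Y(2) char_form_dist_matrix_eq_0_iff[OF Y(2), of R]
    by (auto simp: graph_dist_le_diam subset_iff)
  show "graph_dist R x y \<le> w" if "x \<in> Y" "y \<in> Y" for x y
    using Max_ge[OF fin in_S[OF that]] by (simp add: width_def)
  have "Max ?S \<in> ?S"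
    by (rule Max_in) (use fin in_S Y(1) in auto)
  then show "\<exists>x\<in>Y. \<exists>y\<in>Y. graph_dist R x y = w"
    using char_form_dist_matrix_eq_0_iff[OF Y(2), of R] by (auto simp: width_def)
qed

lemma in_BY_iff:
  "M \<in> BY \<longleftrightarrow> (\<exists>f. \<forall>x y. M $ x $ y = (if x \<in> Y \<and> y \<in> Y then f (graph_dist R x y) else 0))"
  by (rule in_span_dist_matrix_iff) (rule width_props(1))

lemma BY_symmetric: "M \<in> BY \<Longrightarrow> transpose M = M"
  by (erule symmetric_span[rotated]) (auto simp: transpose_dist_matrix symR)

lemma e_in_BY: "j \<le> d \<Longrightarrow> e j \<in> BY"
proof -
  assume "j \<le> d"
  then obtain f where "\<And>x y. E j $ x $ y = (if x \<in> X \<and> y \<in> X then f (graph_dist R x y) else 0)"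
    using E_primitive in_bose_mesner_iff[OF dr] unfolding primitive_idempotent_def by metis
  then have "\<forall>x y. e j $ x $ y = (if x \<in> Y \<and> y \<in> Y then f (graph_dist R x y) else 0)"
    using Y(2) by auto
  then show ?thesis unfolding in_BY_iff by blast
qed

lemma L_subset_BY: "k \<le> Suc d \<Longrightarrow> L k \<subseteq> BY"
  by (rule cmat.span_minimal) (auto simp: cmat.subspace_span intro!: e_in_BY)

lemma T_subset_BY: "T k \<subseteq> BY"
  by (rule cmat.span_minimal) (auto simp: cmat.subspace_span intro!: e_in_BY)

text \<open>The tail of the expansion has indices above \<open>j - i\<close>, so its form on
  \<open>Y\<close> vanishes once \<open>s \<le> j - i\<close>. What is left is a nonzero multiple of
  the form of \<open>E (j - i)\<close>, which is zero beyond \<open>s\<close> and nonzero at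
  \<open>s\<close>.\<close>

lemma char_form_hadamard_E:
  assumes "i \<le> j" "j \<le> d"
  shows "s < j - i \<Longrightarrow> char_form Y (hadamard (E i) (E j)) = 0"
    and "j = s + i \<Longrightarrow> char_form Y (hadamard (E i) (E j)) \<noteq> 0"
proof -
  obtain q N where q: "q \<noteq> 0" and N: "N \<in> cmat.span (E ` {j - i<..d})"
    and EE: "hadamard (E i) (E j) = cmat_scale q (E (j - i)) + N"
    using q_polynomial_hadamard[OF dr qpoly diam_pos assms] by blast
  have "char_form Y N = 0" if "s \<le> j - i"
    using N by (rule char_form_span_eq_0[rotated])
      (use that dual_width_props(3)[OF Y(2,1)] in auto)
  then show "s < j - i \<Longrightarrow> char_form Y (hadamard (E i) (E j)) = 0"
    and "j = s + i \<Longrightarrow> char_form Y (hadamard (E i) (E j)) \<noteq> 0"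
    using dual_width_props(2,3)[OF Y(2,1)] assms q
    unfolding EE char_form_add char_form_scale by auto
qed

lemma e_mult_eq_0: "s + i < j \<Longrightarrow> j \<le> d \<Longrightarrow> e i ** e j = 0"
  by (rule principal_submatrix_mult_eq_0)
    (auto intro!: E_sym E_real E_idem char_form_hadamard_E)

text \<open>\<open>e j\<close> is tested against \<open>E (s + j)\<close>, which exists because
  \<open>j \<le> w = d - s\<close>. For \<open>i < j\<close> the index gap exceeds
  \<open>s\<close>.\<close>

lemma indep_family_e_lower: "indep_family e {..w}"
proof (rule indep_family_triangular[where r = id and g = "\<lambda>j. E (s + j)" and Y = Y])
  fix i j assume "i \<in> {..w}" "j \<in> {..w}" "id i < id j"
  then show "char_form Y (hadamard (e i) (E (s + j))) = 0"
    using Y(3) unfolding char_form_hadamard_principal_submatrix by (intro char_form_hadamard_E) auto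
next
  fix j assume "j \<in> {..w}"
  then show "char_form Y (hadamard (e j) (E (s + j))) \<noteq> 0"
    using Y(3) unfolding char_form_hadamard_principal_submatrix by (intro char_form_hadamard_E) auto
qed auto

text \<open>The mirror image: \<open>e j\<close> is tested against \<open>E (j - s)\<close>, and it
  is now the larger index that has too wide a gap, hence the reversed rank
  \<open>d - j\<close>.\<close>

lemma indep_family_e_upper: "indep_family e {s..d}"
proof (rule indep_family_triangular[where r = "\<lambda>j. d - j" and g = "\<lambda>j. E (j - s)" and Y = Y])
  fix i j assume "i \<in> {s..d}" "j \<in> {s..d}" "d - i < d - j"
  then show "char_form Y (hadamard (e i) (E (j - s))) = 0"
    unfolding char_form_hadamard_principal_submatrix hadamard_commute[of "E i"]
    by (intro char_form_hadamard_E) auto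
next
  fix j assume "j \<in> {s..d}"
  then show "char_form Y (hadamard (e j) (E (j - s))) \<noteq> 0"
    unfolding char_form_hadamard_principal_submatrix hadamard_commute[of "E j"]
    by (intro char_form_hadamard_E) auto
qed (auto simp: inj_on_def)

lemma L_mult_T_eq_0:
  assumes "k \<le> Suc w" "M \<in> L k" "N \<in> T k"
  shows "M ** N = 0"
  using _ assms(2,3)
proof (rule matrix_mult_span_eq_0)
  fix A B assume "A \<in> e ` {..<k}" "B \<in> e ` {s + k..d}"
  then show "A ** B = 0" by (auto intro!: e_mult_eq_0)
qed

text \<open>The \<open>e j\<close> are real, so \<open>L k\<close> is closed under conjugation and
  \<open>cnj_mat M ** M\<close> is a product of an element of \<open>L k\<close> with one of
  \<open>T k\<close>.\<close>

lemma L_Int_T: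
  assumes k: "k \<le> Suc w" and M: "M \<in> L k" "M \<in> T k"
  shows "M = 0"
proof (rule cnj_mult_symmetric_eq_0)
  show "transpose M = M"
    using M(2) T_subset_BY BY_symmetric by blast
  have "cnj_mat M \<in> L k"
    using M(1) by (rule cnj_mat_span[rotated]) (use k Y(3) in \<open>auto simp: e_real\<close>)
  then show "cnj_mat M ** M = 0"
    using L_mult_T_eq_0 k M(2) by blast
qed

text \<open>There are \<open>w + 1\<close> independent matrices inside a span of
  \<open>w + 1\<close> generators.\<close>

lemma BY_eq_L: "BY = L (Suc w)"
proof
  have "BY \<subseteq> cmat.span (e ` {..w})"
    by (rule span_subset_indep_family[OF indep_family_e_lower])
      (use Y(3) in \<open>auto intro!: e_in_BY\<close>)
  then show "BY \<subseteq> L (Suc w)" by (simp add: lessThan_Suc_atMost)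
  show "L (Suc w) \<subseteq> BY" by (rule L_subset_BY) (use Y(3) in simp)
qed

lemma BY_eq_T: "BY = T 0"
proof
  show "BY \<subseteq> T 0"
    unfolding add_0_right
    by (rule span_subset_indep_family[OF indep_family_e_upper])
      (use Y(3) in \<open>auto intro!: e_in_BY\<close>)
qed (rule T_subset_BY)

text \<open>A relation among the generators of \<open>L k\<close> and \<open>T k\<close> equates an
  element of one with an element of the other, so both vanish and each half is a relation inside a
  known independent family. The \<open>k + (w + 1 - k)\<close> generators therefore fill
  \<open>BY\<close>.\<close>

lemma BY_decompose:
  assumes k: "k \<le> Suc w" and M: "M \<in> BY"
  obtains l t where "l \<in> L k" "t \<in> T k" "M = l + t"
proof -
  have disj: "{..<k} \<inter> {s + k..d} = {}" by auto
  have "indep_family e ({..<k} \<union> {s + k..d})"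
    unfolding indep_family_def
  proof (intro allI impI ballI)
    fix c j assume z: "(\<Sum>i\<in>{..<k} \<union> {s + k..d}. cmat_scale (c i) (e i)) = 0"
      and j: "j \<in> {..<k} \<union> {s + k..d}"
    define l where "l = (\<Sum>i\<in>{..<k}. cmat_scale (c i) (e i))"
    define t where "t = (\<Sum>i\<in>{s + k..d}. cmat_scale (c i) (e i))"
    have "l + t = 0"
      using z disj by (simp add: l_def t_def sum.union_disjoint)
    then have lt: "l = - t" by (simp add: eq_neg_iff_add_eq_0)
    have t: "t \<in> T k" and l: "l \<in> L k"
      unfolding t_def l_def by (intro cmat.span_sum cmat.span_scale, rule cmat.span_base, blast)+
    have "l = 0"
      by (rule L_Int_T[OF k l]) (use t lt in \<open>simp add: cmat.span_neg\<close>)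
    then have z: "l = 0" "t = 0" using lt by auto
    have "indep_family e {..<k}" "indep_family e {s + k..d}"
      by (rule indep_family_subset[OF indep_family_e_lower], use k in auto)
        (rule indep_family_subset[OF indep_family_e_upper], auto)
    then show "c j = 0"
      using z j unfolding l_def t_def by (auto dest: indep_familyD)
  qed
  moreover have "card ({..<k} \<union> {s + k..d}) = Suc w"
    using disj k Y(3) by (simp add: card_Un_disjoint)
  ultimately have "BY \<subseteq> cmat.span (e ` ({..<k} \<union> {s + k..d}))"
    by (intro span_subset_indep_family) (use k Y(3) in \<open>auto intro!: e_in_BY\<close>)
  then have "M \<in> cmat.span (e ` {..<k} \<union> e ` {s + k..d})"
    using M by (auto simp: image_Un)
  then show ?thesis
    using that unfolding cmat.span_Un by blast
qed

lemma dist_matrix_0_BY: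
  assumes "M \<in> BY"
  shows "dist_matrix Y R 0 ** M = M" "M ** dist_matrix Y R 0 = M"
proof -
  have supp: "x \<in> Y \<and> y \<in> Y" if "M $ x $ y \<noteq> 0" for x y
    using assms that unfolding in_BY_iff by metis
  then show "dist_matrix Y R 0 ** M = M" "M ** dist_matrix Y R 0 = M"
    by (intro dist_matrix_0_mult[OF con Y(2)]; simp)+
qed

text \<open>Modulo \<open>T (k + 1)\<close>, which annihilates \<open>L (k + 1)\<close> from the right, the identity of \<open>BY\<close> is a
  combination of \<open>e 0, \<dots>, e k\<close> in which \<open>e k\<close> occurs. This expresses the square of \<open>e k\<close>
  through \<open>e k\<close> and its products with \<open>e 0, \<dots>, e (k - 1)\<close>.\<close>

lemma L_mult_BY:
  "k \<le> Suc w \<Longrightarrow> M \<in> L k \<Longrightarrow> N \<in> BY \<Longrightarrow> M ** N \<in> L k"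
proof (induction k arbitrary: M N)
  case 0
  then show ?case by (simp add: matrix_matrix_mult_def zero_vec_def)
next
  case (Suc k)
  have mono: "L k \<subseteq> L (Suc k)" by (rule cmat.span_mono) auto
  have k: "k \<le> w" "k \<le> d" using Suc.prems Y(3) by auto
  have ek: "e k \<in> L (Suc k)" by (rule cmat.span_base) auto
  have L_split: "\<exists>l' \<gamma>. l' \<in> L k \<and> l = l' + cmat_scale \<gamma> (e k)" if l: "l \<in> L (Suc k)" for l
  proof -
    have "e ` {..<Suc k} = insert (e k) (e ` {..<k})" by (auto simp: less_Suc_eq)
    then obtain \<gamma> where "l - cmat_scale \<gamma> (e k) \<in> L k"
      using l by (auto simp: cmat.span_breakdown_eq)
    then show ?thesis by (intro exI[of _ "l - cmat_scale \<gamma> (e k)"] exI[of _ \<gamma>]) simp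
  qed
  \<comment> \<open>The induction hypothesis covers the product in the other order; lying in
    \<open>BY\<close>, that product is symmetric, so transposing it reverses the factors.\<close>
  have low: "e k ** l \<in> L k" if "l \<in> L k" for l
  proof -
    have "l ** e k \<in> L k" by (rule Suc.IH) (use k that e_in_BY in auto)
    moreover from this have "transpose (l ** e k) = l ** e k"
      using L_subset_BY[of k] k BY_symmetric by auto
    moreover have "transpose (l ** e k) = e k ** l"
      by (rule transpose_mult_symmetric) (use that L_subset_BY[of k] k BY_symmetric e_sym in auto)
    ultimately show ?thesis by simp
  qed
  have I_in: "dist_matrix Y R 0 \<in> BY" by (auto intro: cmat.span_base)
  have square: "e k ** e k \<in> L (Suc k)"
  proof -
    obtain l t where lt: "l \<in> L (Suc k)" "t \<in> T (Suc k)" "dist_matrix Y R 0 = l + t"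
      using BY_decompose[OF Suc.prems(1) I_in] .
    obtain l' \<gamma> where l': "l' \<in> L k" "l = l' + cmat_scale \<gamma> (e k)"
      using L_split[OF lt(1)] by blast
    have "e k = e k ** dist_matrix Y R 0"
      using dist_matrix_0_BY(2)[OF e_in_BY[OF k(2)]] by simp
    also have "\<dots> = e k ** l' + cmat_scale \<gamma> (e k ** e k)"
      using L_mult_T_eq_0[OF Suc.prems(1) ek lt(2)]
      by (simp add: lt(3) l'(2) matrix_add_ldistrib matrix_mult_scale)
    finally have eq: "e k = e k ** l' + cmat_scale \<gamma> (e k ** e k)" .
    \<comment> \<open>With \<open>\<gamma> = 0\<close> the equation above would put
      \<open>e k = e k ** l'\<close> into \<open>L k\<close>, against independence.\<close>
    have "e k \<notin> L k"
      by (rule indep_family_not_in_span[OF indep_family_e_lower]) (use k in auto)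
    then have "\<gamma> \<noteq> 0" using eq low[OF l'(1)] by (metis add.right_neutral cmat.scale_zero_left)
    have "cmat_scale \<gamma> (e k ** e k) = e k - e k ** l'"
      by (subst (3) eq) simp
    also have "\<dots> \<in> L (Suc k)"
      using ek low[OF l'(1)] mono by (intro cmat.span_diff) auto
    finally have "cmat_scale \<gamma> (e k ** e k) \<in> L (Suc k)" .
    then have "cmat_scale (1 / \<gamma>) (cmat_scale \<gamma> (e k ** e k)) \<in> L (Suc k)"
      by (rule cmat.span_scale)
    then show ?thesis using \<open>\<gamma> \<noteq> 0\<close> by simp
  qed
  have ek_BY: "e k ** N \<in> L (Suc k)"
  proof -
    obtain l t where lt: "l \<in> L (Suc k)" "t \<in> T (Suc k)" "N = l + t"
      using BY_decompose[OF Suc.prems(1) Suc.prems(3)] .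
    obtain l' \<gamma> where l': "l' \<in> L k" "l = l' + cmat_scale \<gamma> (e k)"
      using L_split[OF lt(1)] by blast
    have "e k ** N = e k ** l' + cmat_scale \<gamma> (e k ** e k)"
      using L_mult_T_eq_0[OF Suc.prems(1) ek lt(2)]
      by (simp add: lt(3) l'(2) matrix_add_ldistrib matrix_mult_scale)
    then show ?thesis
      using low[OF l'(1)] mono square by (auto intro!: cmat.span_add cmat.span_scale)
  qed
  show ?case
    using _ Suc.prems(2)
  proof (rule matrix_mult_span_left)
    fix A assume "A \<in> e ` {..<Suc k}"
    then have "A = e k \<or> A \<in> e ` {..<k}" by (auto simp: less_Suc_eq)
    then consider "A = e k" | "A \<in> L k"
      using cmat.span_base[of A "e ` {..<k}"] by argo
    then show "A ** N \<in> L (Suc k)"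
      using ek_BY Suc.IH[of A N] k Suc.prems(3) mono by cases auto
  qed
qed

lemma BY_mult: "M \<in> BY \<Longrightarrow> N \<in> BY \<Longrightarrow> M ** N \<in> BY"
  using L_mult_BY[of "Suc w"] BY_eq_L by simp

lemma BY_commute: "M \<in> BY \<Longrightarrow> N \<in> BY \<Longrightarrow> M ** N = N ** M"
  using transpose_mult_symmetric[of M N] BY_symmetric BY_mult by simp

end

section \<open>The induced subgraph on a descendent\<close>

locale connected_descendent = q_polynomial_descendent +
  assumes conY: "connected_graph Y (induced_edges R Y)"
begin

abbreviation "RY \<equiv> induced_edges R Y"

lemma dist_matrix_Y_in_BY: "i \<le> w \<Longrightarrow> dist_matrix Y R i \<in> BY"
  by (rule cmat.span_base) auto

lemma relpow_induced_edges: "(x, y) \<in> RY ^^ n \<Longrightarrow> (x, y) \<in> R ^^ n"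
  by (induction n arbitrary: y) (auto simp: induced_edges_def)

text \<open>Closure of \<open>BY\<close> makes the number of neighbours of \<open>y\<close> inside
  \<open>Y\<close> at distance \<open>h\<close> from \<open>x\<close> depend only on the distance of
  \<open>x\<close> and \<open>y\<close>. It therefore suffices to find one pair at distance
  \<open>h + 1\<close> where this number is nonzero, and a walk inside \<open>Y\<close> supplies
  it.\<close>

lemma pred_in_Y:
  assumes xy: "x \<in> Y" "y \<in> Y" "graph_dist R x y = Suc h"
  obtains z where "z \<in> Y" "(z, y) \<in> R" "graph_dist R x z = h"
proof -
  have h: "Suc h \<le> w" using width_props(1)[OF xy(1,2)] xy(3) by simp
  have "dist_matrix Y R h ** dist_matrix Y R 1 \<in> BY"
    using h by (intro BY_mult dist_matrix_Y_in_BY) auto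
  then obtain f where f: "\<And>x y. (dist_matrix Y R h ** dist_matrix Y R 1) $ x $ y =
      (if x \<in> Y \<and> y \<in> Y then f (graph_dist R x y) else 0)"
    unfolding in_BY_iff by blast
  have count: "f (graph_dist R x y) = of_nat (card {z \<in> Y. (y, z) \<in> R \<and> graph_dist R x z = h})"
    if "x \<in> Y" "y \<in> Y" for x y
    using f[of x y] dist_matrix_mult_adjacency[OF con sg Y(2) that, of h] that Y(2) by auto
  \<comment> \<open>A pair at the largest distance \<open>w\<close>: a walk joining it inside
    \<open>Y\<close> must cross every level \<open>h < w\<close>.\<close>
  obtain x0 y0 where x0: "x0 \<in> Y" "y0 \<in> Y" "graph_dist R x0 y0 = w"
    using width_props(2) by blast
  have walk: "(x0, y0) \<in> RY\<^sup>*" using conY x0 by (auto simp: connected_graph_def)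
  have sub: "RY \<subseteq> R" and "x0 \<in> X" and "Suc h \<le> graph_dist R x0 y0"
    using x0 Y(2) h by (auto simp: induced_edges_def)
  then obtain u v where uv: "(u, v) \<in> RY" "graph_dist R x0 u = h" "graph_dist R x0 v = Suc h"
    using walk_crosses_level[OF con sub RX _ walk] by blast
  then have "u \<in> Y" "v \<in> Y" "(v, u) \<in> R"
    using symR by (auto simp: induced_edges_def dest: symD)
  then have "card {z \<in> Y. (v, z) \<in> R \<and> graph_dist R x0 z = h} \<noteq> 0"
    using uv(2) by auto
  then have "f (Suc h) \<noteq> 0"
    using count[OF x0(1) \<open>v \<in> Y\<close>] uv(3) by simp
  then have "card {z \<in> Y. (y, z) \<in> R \<and> graph_dist R x z = h} \<noteq> 0"
    using count[OF xy(1,2)] xy(3) by simp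
  then have "{z \<in> Y. (y, z) \<in> R \<and> graph_dist R x z = h} \<noteq> {}"
    by force
  then show ?thesis using that symR by (auto dest: symD)
qed

text \<open>Stepping back repeatedly to a predecessor in \<open>Y\<close> builds an ambient geodesic
  that stays inside \<open>Y\<close>.\<close>

lemma graph_dist_induced_edges:
  assumes "x \<in> Y" "y \<in> Y"
  shows "graph_dist RY x y = graph_dist R x y"
proof (rule antisym)
  show "graph_dist R x y \<le> graph_dist RY x y"
    by (intro graph_dist_le relpow_induced_edges relpow_graph_dist[OF conY assms])
  have "(x, y) \<in> RY ^^ h" if "y \<in> Y" "graph_dist R x y = h" for y h
    using that
  proof (induction h arbitrary: y)
    case 0
    then show ?case using graph_dist_eq_0_iff[OF con, of x y] assms(1) Y(2) by auto
  next
    case (Suc h)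
    then obtain z where "z \<in> Y" "(z, y) \<in> R" "graph_dist R x z = h"
      using pred_in_Y[OF assms(1)] by blast
    then show ?case using Suc by (auto simp: induced_edges_def)
  qed
  then show "graph_dist RY x y \<le> graph_dist R x y"
    using assms(2) by (intro graph_dist_le) auto
qed

lemma dist_matrix_induced_edges: "dist_matrix Y RY i = dist_matrix Y R i"
  by (auto simp: vec_eq_iff graph_dist_induced_edges)

lemma graph_diam_induced_edges: "graph_diam Y RY = w"
proof (rule antisym)
  show "graph_diam Y RY \<le> w"
    using graph_diam_attained[OF Y(1), of RY] width_props(1) graph_dist_induced_edges by metis
  show "w \<le> graph_diam Y RY"
    using width_props(2) graph_dist_le_diam graph_dist_induced_edges by metis
qed

text \<open>Distances within \<open>Z\<close> never exceed \<open>w\<close>, so lowering the index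
  bound from \<open>d\<close> to \<open>w\<close> discards nothing.\<close>

lemma width_induced_edges:
  assumes "Z \<subseteq> Y"
  shows "width Y RY Z = width X R Z"
proof -
  have "i \<le> w \<and> char_form Z (dist_matrix Y R i) \<noteq> 0 \<longleftrightarrow>
      i \<le> d \<and> char_form Z (dist_matrix X R i) \<noteq> 0" for i
    using width_props(1) assms Y(2,3) char_form_dist_matrix_eq_0_iff[of Z _ R i]
    by (auto simp: subset_iff)
  then show ?thesis
    unfolding width_def graph_diam_induced_edges dist_matrix_induced_edges by simp
qed

section \<open>The induced idempotents and the shift of the dual width\<close>

context
  fixes E' assumes E': "induced_ordering X R E Y E'"
begin

lemma E'_bij_betw: "bij_betw E' {..w} {P. primitive_idempotent BY P}"
  using E' unfolding induced_ordering_def Let_def principal_submatrix_dist_matrix[OF Y(2)] by simp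

lemma span_E'_lower: "k \<le> Suc w \<Longrightarrow> cmat.span (E' ` {..<k}) = L k"
  using E' by (cases k) (auto simp: induced_ordering_def Let_def lessThan_Suc_atMost)

lemma E'_primitive_idempotent: "i \<le> w \<Longrightarrow> primitive_idempotent BY (E' i)"
  using E'_bij_betw by (auto simp: bij_betw_def)

lemma E'_mult:
  assumes "i \<le> w" "j \<le> w"
  shows "E' i ** E' j = (if i = j then E' i else 0)"
proof (cases "i = j")
  case True
  then show ?thesis using E'_primitive_idempotent assms by (auto simp: primitive_idempotent_def)
next
  case False
  then have "E' i \<noteq> E' j"
    using E'_bij_betw assms by (auto simp: bij_betw_def inj_on_def)
  then show ?thesis
    using primitive_idempotents_orthogonal[OF cmat.subspace_span BY_mult BY_commute
        E'_primitive_idempotent[OF assms(1)] E'_primitive_idempotent[OF assms(2)]] False by simp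
qed

lemma E'_nonzero: "i \<le> w \<Longrightarrow> E' i \<noteq> 0"
  using E'_primitive_idempotent by (auto simp: primitive_idempotent_def)

text \<open>Expand an element of \<open>T k\<close> in the \<open>E' i\<close>. Multiplying by
  \<open>E' j\<close> isolates the \<open>j\<close>-th coefficient, and for \<open>j < k\<close> the
  product is zero because \<open>E' j\<close> lies in \<open>L k\<close>. Both spans have
  \<open>w + 1 - k\<close> generators, so counting gives equality.\<close>

lemma span_E'_upper:
  assumes k: "k \<le> Suc w"
  shows "cmat.span (E' ` {k..w}) = T k"
proof
  have sub: "T k \<subseteq> cmat.span (E' ` {k..w})"
  proof
    fix M assume M: "M \<in> T k"
    then have "M \<in> cmat.span (E' ` {..<Suc w})"
      using T_subset_BY[of k] BY_eq_L span_E'_lower[of "Suc w"] by auto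
    then obtain c where c: "M = (\<Sum>i\<in>{..<Suc w}. cmat_scale (c i) (E' i))"
      by (rule span_image_eq_sum[rotated]) auto
    have coeff: "E' j ** M = cmat_scale (c j) (E' j)" if "j \<le> w" for j
    proof -
      have "E' j ** M = (\<Sum>i\<in>{..<Suc w}. if i = j then cmat_scale (c j) (E' j) else 0)"
        unfolding c matrix_mult_sum matrix_mult_scale
        by (intro sum.cong refl) (use that E'_mult in auto)
      then show ?thesis using that by simp
    qed
    have zero: "c j = 0" if "j < k" for j
    proof -
      have j: "j \<le> w" using that k by simp
      have "E' j \<in> cmat.span (E' ` {..<k})" using that by (intro cmat.span_base) auto
      then have "E' j ** M = 0"
        using L_mult_T_eq_0[OF k _ M] span_E'_lower[OF k] by simp
      then show ?thesis using coeff[OF j] E'_nonzero[OF j] by simp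
    qed
    have "M = (\<Sum>i\<in>{k..w}. cmat_scale (c i) (E' i))"
      unfolding c by (rule sum.mono_neutral_right) (use zero in auto)
    then show "M \<in> cmat.span (E' ` {k..w})"
      by (metis (no_types, lifting) cmat.span_sum cmat.span_scale cmat.span_base imageI)
  qed
  then show "T k \<subseteq> cmat.span (E' ` {k..w})" .
  show "cmat.span (E' ` {k..w}) \<subseteq> T k"
  proof (rule span_subset_indep_family)
    show "indep_family e {s + k..d}"
      by (rule indep_family_subset[OF indep_family_e_upper]) auto
    show "e ` {s + k..d} \<subseteq> cmat.span (E' ` {k..w})"
      using sub cmat.span_superset by blast
  qed (use Y(3) k in auto)
qed

text \<open>The tail of \<open>E'\<close> from \<open>k + 1\<close> and the tail of \<open>e\<close>
  from \<open>s + k + 1\<close> span the same space, so the form of \<open>Z\<close> vanishes on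
  both or on neither. Comparing the tails beyond each dual width gives the two inequalities.\<close>

lemma dual_width_induced_edges:
  assumes Z: "Z \<subseteq> Y" "Z \<noteq> {}"
  shows "dual_width X R E Z = dual_width Y RY E' Z + s"
proof -
  have ZX: "Z \<subseteq> X" using Z Y(2) by simp
  define m where "m = dual_width X R E Z"
  define k where "k = dual_width Y RY E' Z"
  note m = dual_width_props[OF ZX Z(2), folded m_def]
  have e_E: "char_form Z (e j) = char_form Z (E j)" for j
    by (rule char_form_principal_submatrix[OF Z(1)])
  have I_nz: "char_form Z (dist_matrix Y R 0) \<noteq> 0"
    using char_form_dist_matrix_eq_0_iff[OF Z(1)] Z(2) by fastforce
  have I_in: "dist_matrix Y R 0 \<in> BY" by (rule dist_matrix_Y_in_BY) simp
  \<comment> \<open>The identity on \<open>Y\<close> has nonzero form on \<open>Z\<close> and is a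
    combination of \<open>e s, ..., e d\<close>, so one of these has nonzero form. This also makes
    the subtraction \<open>m - s\<close> below exact.\<close>
  have sm: "s \<le> m"
  proof (rule ccontr)
    assume "\<not> s \<le> m"
    then have "char_form Z (dist_matrix Y R 0) = 0"
      using I_in unfolding BY_eq_T
      by (elim char_form_span_eq_0[rotated]) (use m(3) e_E in auto)
    then show False using I_nz by simp
  qed
  let ?S = "{i. i \<le> w \<and> char_form Z (E' i) \<noteq> 0}"
  have kS: "k = Max ?S"
    unfolding k_def dual_width_def graph_diam_induced_edges ..
  have fin: "finite ?S" by simp
  \<comment> \<open>The same identity matrix, expanded in the \<open>E' i\<close>, shows that the
    maximum defining \<open>k\<close> is attained.\<close>
  have "?S \<noteq> {}"
  proof
    assume e: "?S = {}"
    have "dist_matrix Y R 0 \<in> cmat.span (E' ` {..<Suc w})"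
      using I_in BY_eq_L span_E'_lower[of "Suc w"] by simp
    then have "char_form Z (dist_matrix Y R 0) = 0"
      by (rule char_form_span_eq_0[rotated]) (use e in auto)
    then show False using I_nz by simp
  qed
  then have k: "k \<le> w" using Max_in[OF fin] kS by auto
  have k_above: "char_form Z (E' h) = 0" if "k < h" "h \<le> w" for h
    using Max_ge[OF fin, of h] that kS by fastforce
  have "m \<le> s + k"
  proof (rule ccontr)
    assume "\<not> m \<le> s + k"
    then have "e m \<in> T (Suc k)"
      using m(1) by (intro cmat.span_base) auto
    then have "e m \<in> cmat.span (E' ` {Suc k..w})"
      using span_E'_upper[of "Suc k"] k by simp
    then have "char_form Z (e m) = 0"
      by (rule char_form_span_eq_0[rotated]) (use k_above in auto)
    then show False using m(2) e_E by simp
  qed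
  moreover have "k \<le> m - s"
  proof (rule ccontr)
    assume "\<not> k \<le> m - s"
    then have "E' k \<in> cmat.span (E' ` {Suc (m - s)..w})"
      using k by (intro cmat.span_base) auto
    then have "E' k \<in> T (Suc (m - s))"
      using span_E'_upper[of "Suc (m - s)"] m(1) Y(3) by simp
    then have "char_form Z (E' k) = 0"
      by (rule char_form_span_eq_0[rotated]) (use m(3) e_E sm in auto)
    then show False using Max_in[OF fin \<open>?S \<noteq> {}\<close>] kS by auto
  qed
  ultimately show ?thesis using sm by (simp add: m_def k_def)
qed

text \<open>The width of \<open>Z\<close> is unchanged, while its dual width and the diameter both
  drop by \<open>s\<close>, the latter from \<open>d = w + s\<close> to \<open>w\<close>.\<close>

lemma descendent_induced_edges_iff:
  assumes Z: "Z \<subseteq> Y" "Z \<noteq> {}"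
  shows "descendent Y RY E' Z \<longleftrightarrow> descendent X R E Z"
  using Z Y dual_width_induced_edges[OF Z] width_induced_edges[OF Z(1)]
  by (auto simp: descendent_def graph_diam_induced_edges)

end

end

theorem mainTheorem5:
  fixes X Y Z :: "'v::finite set"
    and R :: "('v \<times> 'v) set"
    and E E' :: "nat \<Rightarrow> complex^'v^'v"
  assumes "distance_regular X R"
    and "graph_diam X R \<ge> 3"
    and "q_polynomial X R E"
    and "nontrivial_descendent X R E Y"
    and "distance_regular Y (induced_edges R Y)"
    and "induced_ordering X R E Y E'"
    and "Z \<subseteq> Y" and "Z \<noteq> {}"
  shows "descendent Y (induced_edges R Y) E' Z \<longleftrightarrow> descendent X R E Z"
proof -
  interpret connected_descendent X R E Y
    using assms(1-5)
    by unfold_locales (auto simp: nontrivial_descendent_def distance_regular_def)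
  show ?thesis
    by (rule descendent_induced_edges_iff[OF assms(6-8)])
qed

end
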